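(* Let $n\ge 0$. In each of the following four groups, all the listed statistics (pairs) are equidistributed on the symmetric group $\mathfrak S_n$, i.e. for any two pairs $(s_1,s_2)$, $(s_1',s_2')$ in the same group and every possible value $(a,b)$ one has $\#\{\sigma\in\mathfrak S_n:(s_1,s_2)\sigma=(a,b)\}=\#\{\sigma\in\mathfrak S_n:(s_1',s_2')\sigma=(a,b)\}$: (1) $(\mathrm{fix},\mathrm{maj})$, $(\mathrm{fix},\mathrm{maf})$, $(\mathrm{fix},\mathrm{maz})$, $(\mathrm{pix},\mathrm{mag})$, $(\mathrm{pix},\mathrm{inv})$, $(\mathrm{pix},\mathrm{imaj})$; (2) $(\mathrm{FIX},\mathrm{maf})$, $(\mathrm{PIX},\mathrm{mag})$, $(\mathrm{PIX},\mathrm{inv})$; (3) $(\mathrm{fix},\mathrm{DEZ})$, $(\mathrm{fix},\mathrm{DES})$, $(\mathrm{pix},\mathrm{IDES})$; (4) $(\mathrm{FIX},\mathrm{DEZ})$, $(\mathrm{PIX},\mathrm{IDES})$.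
   Context: Permutations $\sigma\in\mathfrak S_n$ are written as words $\sigma(1)\cdots\sigma(n)$. For a word $x_1\cdots x_n$ of nonnegative integers, $\mathrm{DES}=\{i:1\le i\le n-1,\ x_i>x_{i+1}\}$, $\mathrm{maj}=\sum_{i\in\mathrm{DES}}i$. For $\sigma\in\mathfrak S_n$: $\mathrm{FIX}\,\sigma=\{i:\sigma(i)=i\}$, $\mathrm{fix}\,\sigma=\#\mathrm{FIX}\,\sigma$; $\mathrm{IDES}\,\sigma=\mathrm{DES}\,\sigma^{-1}$, $\mathrm{imaj}\,\sigma=\sum_{i\in\mathrm{IDES}\,\sigma}i$; $\mathrm{inv}\,\sigma=\#\{(i,j):i<j,\ \sigma(i)>\sigma(j)\}$. Fixed decomposition: let $j_1<\dots<j_m$ be the non-fixed points of $\sigma$ and $\mathrm{red}$ the increasing bijection of $\{j_1,\dots,j_m\}$ onto $\{1,\dots,m\}$. $\mathrm{Der}\,\sigma=\mathrm{red}\,\sigma(j_1)\cdots\mathrm{red}\,\sigma(j_m)\in\mathfrak S_m$. $\mathrm{ZDer}(\sigma)=x_1\cdots x_n$ with $x_i=0$ if $\sigma(i)=i$ and $x_i=\mathrm{red}\,\sigma(i)$ otherwise. $\mathrm{DEZ}\,\sigma=\mathrm{DES}\,\mathrm{ZDer}(\sigma)$, $\mathrm{maz}\,\sigma=\mathrm{maj}\,\mathrm{ZDer}(\sigma)$, and $\mathrm{maf}\,\sigma=\sum_{i\in\mathrm{FIX}\,\sigma}i-\sum_{i=1}^{\mathrm{fix}\,\sigma}i+\mathrm{maj}(\mathrm{Der}\,\sigma)$.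 Pixed decomposition: a word $y_1\cdots y_m$ with distinct letters is a desarrangement if $y_1>y_2>\dots>y_{2k}$ and $y_{2k}<y_{2k+1}$ for some $k\ge1$, with the convention $y_{m+1}=\infty$ (its leftmost trough is at an even position). Each $\sigma\in\mathfrak S_n$ factors uniquely as $\sigma=\sigma^p\sigma^d$ where $\sigma^p$ is increasing and $\sigma^d$ is the longest right factor of $\sigma$ that is a desarrangement (empty if $\sigma$ is increasing). $\mathrm{PIX}\,\sigma$ is the set of letters of $\sigma^p$ and $\mathrm{pix}\,\sigma=\#\mathrm{PIX}\,\sigma$. $\mathrm{Desar}\,\sigma\in\mathfrak S_m$ ($m$ the length of $\sigma^d$) is $\sigma^d$ with its letters replaced via the increasing bijection of its letter set onto $\{1,\dots,m\}$. $\mathrm{mag}\,\sigma=\sum_{i\in\mathrm{PIX}\,\sigma}i-\sum_{i=1}^{\mathrm{pix}\,\sigma}i+\mathrm{imaj}(\mathrm{Desar}\,\sigma)$. *)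

theory Defs
  imports "HOL-Combinatorics.Permutations"
begin

text \<open>The symmetric group of degree n is the set of functions that permute {1..n}; words
  are lists of natural numbers, whose letters are numbered from 1.\<close>

definition letter :: "nat list \<Rightarrow> nat \<Rightarrow> nat" where
  "letter w i = w ! (i - 1)"

definition perm_word :: "nat \<Rightarrow> (nat \<Rightarrow> nat) \<Rightarrow> nat list" where
  "perm_word n \<sigma> = map \<sigma> [1..<n + 1]"

definition word_perm :: "nat list \<Rightarrow> nat \<Rightarrow> nat" where
  "word_perm w i = (if i \<in> {1..length w} then letter w i else i)"

definition DES_word :: "nat list \<Rightarrow> nat set" where
  "DES_word w = {i \<in> {1..<length w}. letter w i > letter w (i + 1)}"

definition maj_word :: "nat list \<Rightarrow> nat" where
  "maj_word w = (\<Sum>i\<in>DES_word w. i)"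

definition DES :: "nat \<Rightarrow> (nat \<Rightarrow> nat) \<Rightarrow> nat set" where
  "DES n \<sigma> = DES_word (perm_word n \<sigma>)"

definition maj :: "nat \<Rightarrow> (nat \<Rightarrow> nat) \<Rightarrow> nat" where
  "maj n \<sigma> = maj_word (perm_word n \<sigma>)"

definition IDES :: "nat \<Rightarrow> (nat \<Rightarrow> nat) \<Rightarrow> nat set" where
  "IDES n \<sigma> = DES n (inv \<sigma>)"

definition imaj :: "nat \<Rightarrow> (nat \<Rightarrow> nat) \<Rightarrow> nat" where
  "imaj n \<sigma> = (\<Sum>i\<in>IDES n \<sigma>. i)"

definition inversions :: "nat \<Rightarrow> (nat \<Rightarrow> nat) \<Rightarrow> nat" where
  "inversions n \<sigma> = card {(i, j). i \<in> {1..n} \<and> j \<in> {1..n} \<and> i < j \<and> \<sigma> i > \<sigma> j}"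

text \<open>The rank map of a finite set A is its increasing bijection onto {1..card A}.\<close>

definition red :: "nat set \<Rightarrow> nat \<Rightarrow> nat" where
  "red A x = card {a \<in> A. a \<le> x}"

lemma red_strict_mono:
  assumes "finite A"
  shows "strict_mono_on A (red A)"
proof (rule strict_mono_onI)
  fix x y assume "y \<in> A" "x < y"
  then have "{a \<in> A. a \<le> x} \<subseteq> {a \<in> A. a \<le> y}" "y \<in> {a \<in> A. a \<le> y} - {a \<in> A. a \<le> x}"
    by auto
  then have "{a \<in> A. a \<le> x} \<subset> {a \<in> A. a \<le> y}" by blast
  then show "red A x < red A y"
    unfolding red_def using assms by (intro psubset_card_mono) auto
qed

lemma red_bij_betw:
  assumes "finite A"
  shows "bij_betw (red A) A {1..card A}"
proof -
  have inj: "inj_on (red A) A"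
    using red_strict_mono[OF assms] by (rule strict_mono_on_imp_inj_on)
  have "red A ` A \<subseteq> {1..card A}"
  proof safe
    fix x assume "x \<in> A"
    then have "{a \<in> A. a \<le> x} \<noteq> {}" by auto
    then have "red A x \<noteq> 0" using assms unfolding red_def by simp
    moreover have "red A x \<le> card A" unfolding red_def using assms by (intro card_mono) auto
    ultimately show "red A x \<in> {1..card A}" by simp
  qed
  then have "red A ` A = {1..card A}"
    using card_image[OF inj] by (intro card_subset_eq) auto
  with inj show ?thesis by (simp add: bij_betw_def)
qed

definition FIX :: "nat \<Rightarrow> (nat \<Rightarrow> nat) \<Rightarrow> nat set" where
  "FIX n \<sigma> = {i \<in> {1..n}. \<sigma> i = i}"

definition fix_num :: "nat \<Rightarrow> (nat \<Rightarrow> nat) \<Rightarrow> nat" where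
  "fix_num n \<sigma> = card (FIX n \<sigma>)"

definition NFIX :: "nat \<Rightarrow> (nat \<Rightarrow> nat) \<Rightarrow> nat set" where
  "NFIX n \<sigma> = {i \<in> {1..n}. \<sigma> i \<noteq> i}"

definition Der :: "nat \<Rightarrow> (nat \<Rightarrow> nat) \<Rightarrow> nat list" where
  "Der n \<sigma> = map (\<lambda>j. red (NFIX n \<sigma>) (\<sigma> j)) (sorted_list_of_set (NFIX n \<sigma>))"

definition ZDer :: "nat \<Rightarrow> (nat \<Rightarrow> nat) \<Rightarrow> nat list" where
  "ZDer n \<sigma> = map (\<lambda>i. if \<sigma> i = i then 0 else red (NFIX n \<sigma>) (\<sigma> i)) [1..<n + 1]"

definition DEZ :: "nat \<Rightarrow> (nat \<Rightarrow> nat) \<Rightarrow> nat set" where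
  "DEZ n \<sigma> = DES_word (ZDer n \<sigma>)"

definition maz :: "nat \<Rightarrow> (nat \<Rightarrow> nat) \<Rightarrow> nat" where
  "maz n \<sigma> = maj_word (ZDer n \<sigma>)"

text \<open>By the following inequality, the subtractions of natural numbers in the definitions of
  maf and mag below are never truncated.\<close>

lemma sum_upto_card_le:
  fixes A :: "nat set"
  assumes "finite A" "0 \<notin> A"
  shows "(\<Sum>i=1..card A. i) \<le> \<Sum>A"
proof -
  have "(\<Sum>i=1..card A. i) = (\<Sum>x\<in>A. red A x)"
    using sum.reindex_bij_betw[OF red_bij_betw[OF assms(1)], of "\<lambda>i. i"] by simp
  also have "\<dots> \<le> \<Sum>A"
  proof (rule sum_mono)
    fix x assume "x \<in> A"
    have "red A x \<le> card {1..x}"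
      unfolding red_def
    proof (rule card_mono)
      show "{a \<in> A. a \<le> x} \<subseteq> {1..x}"
        using assms(2) by (auto simp: Suc_le_eq intro: gr0I)
    qed simp
    then show "red A x \<le> x" by simp
  qed
  finally show ?thesis .
qed

definition maf :: "nat \<Rightarrow> (nat \<Rightarrow> nat) \<Rightarrow> nat" where
  "maf n \<sigma> = (\<Sum>i\<in>FIX n \<sigma>. i) - (\<Sum>i=1..fix_num n \<sigma>. i) + maj_word (Der n \<sigma>)"

text \<open>The disjunct \<open>2 * k = length w\<close> is the convention that the letter after the last one is
  infinite.\<close>

definition desarrangement :: "nat list \<Rightarrow> bool" where
  "desarrangement w \<longleftrightarrow> distinct w \<and>
     (\<exists>k\<ge>1. 2 * k \<le> length w \<and>
       (\<forall>i\<in>{1..<2 * k}. letter w i > letter w (i + 1)) \<and>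
       (2 * k = length w \<or> letter w (2 * k) < letter w (2 * k + 1)))"

text \<open>The length of the left factor of w that remains when the longest right factor that is
  empty or a desarrangement is removed.\<close>

definition pixed_cut :: "nat list \<Rightarrow> nat" where
  "pixed_cut w = (LEAST l. drop l w = [] \<or> desarrangement (drop l w))"

definition pixed_part :: "nat \<Rightarrow> (nat \<Rightarrow> nat) \<Rightarrow> nat list" where
  "pixed_part n \<sigma> = take (pixed_cut (perm_word n \<sigma>)) (perm_word n \<sigma>)"

definition desar_part :: "nat \<Rightarrow> (nat \<Rightarrow> nat) \<Rightarrow> nat list" where
  "desar_part n \<sigma> = drop (pixed_cut (perm_word n \<sigma>)) (perm_word n \<sigma>)"

definition PIX :: "nat \<Rightarrow> (nat \<Rightarrow> nat) \<Rightarrow> nat set" where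
  "PIX n \<sigma> = set (pixed_part n \<sigma>)"

definition pix_num :: "nat \<Rightarrow> (nat \<Rightarrow> nat) \<Rightarrow> nat" where
  "pix_num n \<sigma> = card (PIX n \<sigma>)"

definition Desar :: "nat \<Rightarrow> (nat \<Rightarrow> nat) \<Rightarrow> nat list" where
  "Desar n \<sigma> = map (red (set (desar_part n \<sigma>))) (desar_part n \<sigma>)"

definition mag :: "nat \<Rightarrow> (nat \<Rightarrow> nat) \<Rightarrow> nat" where
  "mag n \<sigma> = (\<Sum>i\<in>PIX n \<sigma>. i) - (\<Sum>i=1..pix_num n \<sigma>. i) +
     imaj (length (Desar n \<sigma>)) (word_perm (Desar n \<sigma>))"

definition equidistributed :: "nat \<Rightarrow> ((nat \<Rightarrow> nat) \<Rightarrow> 'a \<times> 'b) set \<Rightarrow> bool" where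
  "equidistributed n S \<longleftrightarrow> (\<forall>s\<in>S. \<forall>s'\<in>S. \<forall>a b.
     card {\<sigma>. \<sigma> permutes {1..n} \<and> s \<sigma> = (a, b)} =
     card {\<sigma>. \<sigma> permutes {1..n} \<and> s' \<sigma> = (a, b)})"

end

theory Submission
  imports Defs "HOL-Library.Multiset"
begin

text \<open>
  A permutation is determined by the pair of \<open>Der\<close> and \<open>FIX\<close>, and also by the pair of \<open>Desar\<close> and
  \<open>PIX\<close>. In both cases all pairs of a reduced word of length m and a subset of \<open>{1..n}\<close> with
  n - m elements occur. \<open>DEZ\<close> and \<open>IDES\<close> depend in the same way on the subset and on the
  descents of the word, respectively of its inverse, and \<open>maf\<close>, \<open>mag\<close> and \<open>inversions\<close> are sums of
  one function of the subset and the statistic maj, imaj or inv of the word. So everything follows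
  from three facts.

  For a fixed \<open>Der\<close>, \<open>DES\<close> and \<open>DEZ\<close> are equidistributed: both are the descents of a shuffle of a
  constant word with a word that has the descents of \<open>Der\<close>, and the distribution of the descents of
  such shuffles depends only on the descents of the second word.

  The descents of derangements and the inverse descents of desarrangements are equidistributed, and
  so are imaj and inv on desarrangements. Here one sums over all pairs to obtain
  distributions on the whole symmetric group, which agree by \<open>IDES \<sigma> = DES (inv \<sigma>)\<close> and by
  MacMahon's theorem, and cancels the contributions of the smaller words by induction.

  For a fixed \<open>Der\<close>, \<open>maf\<close> and \<open>maz\<close> are equidistributed: the major index over all shuffles of a
  word with zeros is counted by a q-binomial coefficient.
\<close>

subsection \<open>Distributions as multisets\<close>

text \<open>Kept as a multiset so that equidistribution is an equation, a disjoint union of finite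
  sets gives a sum, and equal summands can be cancelled.\<close>

definition distr :: "('a \<Rightarrow> 'b) \<Rightarrow> 'a set \<Rightarrow> 'b multiset" where
  "distr f A = image_mset f (mset_set A)"

lemma count_distr:
  assumes "finite A"
  shows "count (distr f A) y = card {x \<in> A. f x = y}"
proof -
  have "{x \<in> A. f x = y} = f -` {y} \<inter> A" by auto
  with assms show ?thesis by (simp add: distr_def count_image_mset)
qed

lemma distr_eqI:
  assumes "finite A" "finite B" "\<And>y. card {x \<in> A. f x = y} = card {x \<in> B. g x = y}"
  shows "distr f A = distr g B"
  using assms by (simp add: multiset_eq_iff count_distr)

lemma distr_cong: "(\<And>x. x \<in> A \<Longrightarrow> f x = g x) \<Longrightarrow> distr f A = distr g A"
  unfolding distr_def
  by (metis (mono_tags, lifting) elem_mset_set image_mset_cong mset_set.infinite empty_iff set_mset_empty)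

lemma distr_empty [simp]: "distr f {} = {#}"
  by (simp add: distr_def)

lemma distr_singleton [simp]: "distr f {x} = {#f x#}"
  by (simp add: distr_def)

lemma distr_bij_betw:
  assumes "bij_betw h A B"
  shows "distr g B = distr (\<lambda>x. g (h x)) A"
proof -
  have "mset_set B = image_mset h (mset_set A)"
    using assms by (metis bij_betw_def image_mset_mset_set)
  then show ?thesis by (simp add: distr_def multiset.map_comp comp_def)
qed

lemma distr_image: "inj_on h A \<Longrightarrow> distr g (h ` A) = distr (\<lambda>x. g (h x)) A"
  by (rule distr_bij_betw) (simp add: bij_betw_def)

lemma image_mset_distr: "image_mset g (distr f A) = distr (\<lambda>x. g (f x)) A"
  by (simp add: distr_def multiset.map_comp comp_def)

lemma distr_Un:
  assumes "finite A" "finite B" "A \<inter> B = {}"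
  shows "distr f (A \<union> B) = distr f A + distr f B"
  using assms by (simp add: distr_def mset_set_Union)

lemma distr_Sigma:
  assumes "finite A" "\<And>x. x \<in> A \<Longrightarrow> finite (B x)"
  shows "distr f (Sigma A B) = (\<Sum>x\<in>A. distr (\<lambda>y. f (x, y)) (B x))"
  using assms
proof (induction A rule: finite_induct)
  case (insert a A)
  have "Sigma (insert a A) B = Pair a ` B a \<union> Sigma A B" by auto
  moreover have "distr f (Pair a ` B a \<union> Sigma A B) = distr f (Pair a ` B a) + distr f (Sigma A B)"
    using insert by (intro distr_Un) auto
  ultimately show ?case using insert by (simp add: distr_image inj_on_def)
qed simp

text \<open>Exchanges two families of words inside a sum: when the summand depends on a word only
  through a statistic, equidistribution of the statistic suffices.\<close>

lemma sum_distr_cong: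
  assumes "distr f A = distr g B"
  shows "(\<Sum>x\<in>A. \<phi> (f x)) = (\<Sum>x\<in>B. \<phi> (g x) :: 'a :: comm_monoid_add)"
proof -
  have "(\<Sum>x\<in>A. \<phi> (f x)) = \<Sum>\<^sub># (image_mset \<phi> (distr f A))"
    by (simp add: distr_def multiset.map_comp comp_def sum_unfold_sum_mset)
  also have "\<dots> = (\<Sum>x\<in>B. \<phi> (g x))"
    unfolding assms by (simp add: distr_def multiset.map_comp comp_def sum_unfold_sum_mset)
  finally show ?thesis .
qed

text \<open>Moebius inversion over finite sets: the count for \<open>D x \<subseteq> J\<close> is
  the sum of the counts for \<open>D x = I\<close> over all I \<subseteq> J. Subtracting the proper
  subsets, known by induction, isolates \<open>D x = J\<close>.\<close>

lemma distr_eq_if_subset_counts_eq: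
  fixes D :: "'a \<Rightarrow> 'c set" and E :: "'b \<Rightarrow> 'c set"
  assumes fin: "finite A" "finite B"
    and finD: "\<And>x. x \<in> A \<Longrightarrow> finite (D x)" "\<And>y. y \<in> B \<Longrightarrow> finite (E y)"
    and eq: "\<And>J. finite J \<Longrightarrow> card {x \<in> A. D x \<subseteq> J} = card {y \<in> B. E y \<subseteq> J}"
  shows "distr D A = distr E B"
proof (rule distr_eqI[OF fin])
  have key: "card {x \<in> A. D x = J} = card {y \<in> B. E y = J}" if "finite J" for J
    using that
  proof (induction J rule: finite_psubset_induct)
    case (psubset J)
    have split: "card {x \<in> C. F x \<subseteq> J} = card {x \<in> C. F x = J} + (\<Sum>I\<in>Pow J - {J}. card {x \<in> C. F x = I})"
      if "finite C" for C :: "'d set" and F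
    proof -
      have "{x \<in> C. F x \<subseteq> J} = (\<Union>I\<in>Pow J. {x \<in> C. F x = I})" by auto
      then have "card {x \<in> C. F x \<subseteq> J} = (\<Sum>I\<in>Pow J. card {x \<in> C. F x = I})"
        using that psubset.hyps by (simp only:) (rule card_UN_disjoint, auto)
      also have "\<dots> = card {x \<in> C. F x = J} + (\<Sum>I\<in>Pow J - {J}. card {x \<in> C. F x = I})"
        using psubset.hyps by (intro sum.remove) auto
      finally show ?thesis .
    qed
    have "(\<Sum>I\<in>Pow J - {J}. card {x \<in> A. D x = I}) = (\<Sum>I\<in>Pow J - {J}. card {y \<in> B. E y = I})"
      using psubset.IH by (intro sum.cong) auto
    with split[OF fin(1), of D] split[OF fin(2), of E] eq[OF psubset.hyps] show ?case by simp
  qed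
  fix J
  show "card {x \<in> A. D x = J} = card {y \<in> B. E y = J}"
  proof (cases "finite J")
    case False
    then have "{x \<in> A. D x = J} = {}" "{y \<in> B. E y = J} = {}" using finD by auto
    then show ?thesis by (simp only:) simp
  qed (rule key)
qed

text \<open>The class of size n contributes \<open>a d\<close> itself to the n-th sum, so the sums determine the
  distribution of a size by size.\<close>

lemma distr_eq_if_graded_sums_eq:
  fixes X :: "'a list set" and Y :: "'b list set"
  assumes fin: "\<And>n. finite {d \<in> X. length d \<le> n}" "\<And>n. finite {d \<in> Y. length d \<le> n}"
    and unitX: "\<And>d. d \<in> X \<Longrightarrow> \<Phi> (length d) (length d, a d) = {#a d#}"
    and unitY: "\<And>d. d \<in> Y \<Longrightarrow> \<Phi> (length d) (length d, b d) = {#b d#}"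
    and eq: "\<And>n. (\<Sum>d | d \<in> X \<and> length d \<le> n. \<Phi> n (length d, a d)) =
                   (\<Sum>d | d \<in> Y \<and> length d \<le> n. \<Phi> n (length d, b d))"
  shows "distr (\<lambda>d. (length d, a d)) {d \<in> X. length d \<le> n} =
         distr (\<lambda>d. (length d, b d)) {d \<in> Y. length d \<le> n}"
proof -
  \<comment> \<open>With the strict bound the base case is empty, and the induction step adds
    exactly the words of length n.\<close>
  have "distr (\<lambda>d. (length d, a d)) {d \<in> X. length d < n} =
        distr (\<lambda>d. (length d, b d)) {d \<in> Y. length d < n}" for n
  proof (induction n)
    case (Suc n)
    have split: "{d \<in> Z. length d \<le> n} = {d \<in> Z. length d < n} \<union> {d \<in> Z. length d = n}"
      and disj: "{d \<in> Z. length d < n} \<inter> {d \<in> Z. length d = n} = {}"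
      and lt: "{d \<in> Z. length d < Suc n} = {d \<in> Z. length d < n} \<union> {d \<in> Z. length d = n}"
      for Z :: "'d list set" by auto
    have finX: "finite {d \<in> X. length d < n}" "finite {d \<in> X. length d = n}"
      by (rule finite_subset[OF _ fin(1)[of n]], auto)+
    have finY: "finite {d \<in> Y. length d < n}" "finite {d \<in> Y. length d = n}"
      by (rule finite_subset[OF _ fin(2)[of n]], auto)+
    have top: "(\<Sum>d\<in>Z. \<Phi> n (length d, c d)) = distr c Z"
      if "finite Z" "\<And>d. d \<in> Z \<Longrightarrow> length d = n" "\<And>d. d \<in> Z \<Longrightarrow> \<Phi> n (n, c d) = {#c d#}" for Z :: "'d list set" and c
    proof -
      have "(\<Sum>d\<in>Z. \<Phi> n (length d, c d)) = (\<Sum>d\<in>Z. {#c d#})"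
        using that by (intro sum.cong) auto
      also have "\<dots> = distr c Z"
        using that(1) by (induction Z rule: finite_induct) (auto simp: distr_def)
      finally show ?thesis .
    qed
    have topX: "(\<Sum>d | d \<in> X \<and> length d = n. \<Phi> n (length d, a d)) = distr a {d \<in> X. length d = n}"
      and topY: "(\<Sum>d | d \<in> Y \<and> length d = n. \<Phi> n (length d, b d)) = distr b {d \<in> Y. length d = n}"
      by (rule top; use finX finY unitX unitY in force)+
    have "(\<Sum>d | d \<in> X \<and> length d < n. \<Phi> n (length d, a d)) + distr a {d \<in> X. length d = n} =
          (\<Sum>d | d \<in> Y \<and> length d < n. \<Phi> n (length d, b d)) + distr b {d \<in> Y. length d = n}"
      using eq[of n] finX finY unfolding split sum.union_disjoint[OF finX disj] sum.union_disjoint[OF finY disj] topX topY by simp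
    \<comment> \<open>The shorter words cancel: they contribute only through length and statistic,
      whose distributions agree by the induction hypothesis.\<close>
    moreover have "(\<Sum>d | d \<in> X \<and> length d < n. \<Phi> n (length d, a d)) =
                   (\<Sum>d | d \<in> Y \<and> length d < n. \<Phi> n (length d, b d))"
      by (rule sum_distr_cong[OF Suc.IH])
    ultimately have "distr a {d \<in> X. length d = n} = distr b {d \<in> Y. length d = n}" by simp
    then have "image_mset (Pair n) (distr a {d \<in> X. length d = n}) =
               image_mset (Pair n) (distr b {d \<in> Y. length d = n})" by simp
    then have "distr (\<lambda>d. (length d, a d)) {d \<in> X. length d = n} =
               distr (\<lambda>d. (length d, b d)) {d \<in> Y. length d = n}"
      unfolding image_mset_distr
      using distr_cong[of "{d \<in> X. length d = n}" "\<lambda>d. (length d, a d)" "\<lambda>d. (n, a d)"]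
        distr_cong[of "{d \<in> Y. length d = n}" "\<lambda>d. (length d, b d)" "\<lambda>d. (n, b d)"] by simp
    with Suc.IH show ?case
      unfolding lt by (simp add: distr_Un[OF finX disj] distr_Un[OF finY disj])
  qed simp
  from this[of "Suc n"] show ?thesis by (simp add: less_Suc_eq_le)
qed

lemma equidistributedI:
  assumes "\<And>s. s \<in> S \<Longrightarrow> distr s {\<sigma>. \<sigma> permutes {1..n}} = M"
  shows "equidistributed n S"
  unfolding equidistributed_def
proof (intro ballI allI)
  fix s s' a b assume "s \<in> S" "s' \<in> S"
  then have "count (distr s {\<sigma>. \<sigma> permutes {1..n}}) (a, b) =
             count (distr s' {\<sigma>. \<sigma> permutes {1..n}}) (a, b)" using assms by simp
  then show "card {\<sigma>. \<sigma> permutes {1..n} \<and> s \<sigma> = (a, b)} = card {\<sigma>. \<sigma> permutes {1..n} \<and> s' \<sigma> = (a, b)}"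
    by (simp add: count_distr finite_permutations)
qed

subsection \<open>Words and the rank map\<close>

lemma letter_nth [simp]: "letter w (Suc i) = w ! i"
  by (simp add: letter_def)

lemma length_perm_word [simp]: "length (perm_word n \<sigma>) = n"
  by (simp add: perm_word_def)

lemma letter_map_upt:
  assumes "i \<in> {1..n}"
  shows "letter (map f [1..<n + 1]) i = f i"
  using assms unfolding letter_def by (subst nth_map) (auto simp del: upt_Suc)

lemma DES_map_upt: "DES_word (map f [1..<n + 1]) = {i \<in> {1..<n}. f i > f (Suc i)}"
  unfolding DES_word_def using letter_map_upt[of _ n f] by (auto simp del: upt_Suc)

lemma map_letter_upt: "map (letter w) [1..<length w + 1] = w"
  by (rule nth_equalityI) (auto simp del: upt_Suc)

lemma finite_DES_word [simp]: "finite (DES_word w)"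
  by (simp add: DES_word_def)

lemma red_nth:
  assumes "finite N" "j < card N"
  shows "red N (sorted_list_of_set N ! j) = Suc j"
proof -
  let ?s = "sorted_list_of_set N"
  have len: "length ?s = card N" by simp
  have mono: "?s ! i < ?s ! k" if "i < k" "k < card N" for i k
    using that sorted_wrt_nth_less[OF strict_sorted_list_of_set] len by metis
  have "{a \<in> N. a \<le> ?s ! j} = (!) ?s ` {..j}"
  proof (intro equalityI subsetI)
    fix a assume "a \<in> {a \<in> N. a \<le> ?s ! j}"
    then obtain i where "i < card N" "a = ?s ! i" "?s ! i \<le> ?s ! j"
      using assms len by (metis (no_types, lifting) in_set_conv_nth mem_Collect_eq set_sorted_list_of_set)
    with mono[of j i] show "a \<in> (!) ?s ` {..j}" by (cases "j < i") auto
  next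
    fix a assume "a \<in> (!) ?s ` {..j}"
    then obtain i where i: "i \<le> j" "a = ?s ! i" by auto
    then have "a \<in> N" using assms len by (metis le_less_trans nth_mem set_sorted_list_of_set)
    moreover have "a \<le> ?s ! j" using i mono[of i j] assms(2) by (cases "i = j") auto
    ultimately show "a \<in> {a \<in> N. a \<le> ?s ! j}" by simp
  qed
  moreover have "inj_on ((!) ?s) {..j}"
    using assms by (intro inj_on_nth) auto
  ultimately show ?thesis by (simp add: red_def card_image)
qed

lemma red_in:
  assumes "finite N" "i \<in> N"
  shows "red N i \<in> {1..card N}"
  using red_bij_betw[OF assms(1)] assms(2) by (auto simp: bij_betw_def)

lemma nth_red:
  assumes "finite N" "i \<in> N"
  shows "sorted_list_of_set N ! (red N i - 1) = i"
proof -
  obtain j where "j < card N" "i = sorted_list_of_set N ! j"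
    using assms by (metis in_set_conv_nth set_sorted_list_of_set sorted_list_of_set.length_sorted_key_list_of_set)
  then show ?thesis using red_nth[OF assms(1), of j] by simp
qed

lemma red_less_iff: "finite N \<Longrightarrow> i \<in> N \<Longrightarrow> j \<in> N \<Longrightarrow> red N i < red N j \<longleftrightarrow> i < j"
  using red_strict_mono by (rule strict_mono_on_less)

lemma red_eq_iff: "finite N \<Longrightarrow> i \<in> N \<Longrightarrow> j \<in> N \<Longrightarrow> red N i = red N j \<longleftrightarrow> i = j"
  using red_less_iff[of N i j] red_less_iff[of N j i] by (metis linorder_neqE_nat nat_less_le)

lemma red_Suc: "finite N \<Longrightarrow> Suc i \<in> N \<Longrightarrow> red N (Suc i) = Suc (red N i)"
proof -
  assume "finite N" "Suc i \<in> N"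
  moreover from this have "{a \<in> N. a \<le> Suc i} = insert (Suc i) {a \<in> N. a \<le> i}" by auto
  ultimately show ?thesis by (simp add: red_def)
qed

lemma map_red_sorted_list:
  assumes "finite N"
  shows "map (\<lambda>i. h (red N i)) (sorted_list_of_set N) = map h [1..<card N + 1]"
  using assms by (intro nth_equalityI) (auto simp: red_nth simp del: upt_Suc)

text \<open>The sets \<open>S\<close> in \<open>positions n m\<close> are the possible positions of the other letters in a word of length n
  that contains a given subword of length m.\<close>

definition positions :: "nat \<Rightarrow> nat \<Rightarrow> nat set set" where
  "positions n m = {S. S \<subseteq> {1..n} \<and> card S + m = n}"

lemma finite_positions [simp]: "finite (positions n m)"
  by (rule finite_subset[of _ "Pow {1..n}"]) (auto simp: positions_def)

lemma positions_self [simp]: "positions n n = {{}}"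
  by (auto simp: positions_def dest: finite_subset)

lemma card_compl_positions:
  assumes "S \<in> positions n m"
  shows "card ({1..n} - S) = m"
proof -
  have "S \<subseteq> {1..n}" "card S + m = n" using assms by (auto simp: positions_def)
  then show ?thesis by (simp add: card_Diff_subset finite_subset)
qed

section \<open>Shuffles of a word with copies of one letter, and their descents\<close>

definition ins :: "nat \<Rightarrow> nat \<Rightarrow> nat set \<Rightarrow> nat list \<Rightarrow> nat list" where
  "ins f n S w = map (\<lambda>i. if i \<in> S then f else letter w (red ({1..n} - S) i)) [1..<n + 1]"

text \<open>For f not in w these are the words \<open>ins f n S w\<close>, described by their
  subword instead of the positions. This form can be cut into factors, the other one carries the
  subset; \<open>bij_betw_ins\<close> passes between them.\<close>

definition insertions :: "nat \<Rightarrow> nat \<Rightarrow> nat list \<Rightarrow> nat list set" where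
  "insertions f n w = {z. length z = n \<and> filter (\<lambda>a. a \<noteq> f) z = w}"

lemma filter_upt_sorted_list: "filter (\<lambda>i. i \<notin> S) [1..<n + 1] = sorted_list_of_set ({1..n} - S)"
  by (intro sorted_distinct_set_unique sorted_wrt_filter sorted_upt) (auto simp del: upt_Suc)

lemma ins_in_insertions:
  assumes "S \<in> positions n (length w)" "f \<notin> set w"
  shows "ins f n S w \<in> insertions f n w"
proof -
  let ?N = "{1..n} - S"
  have ne: "letter w (red ?N i) \<noteq> f" if "i \<in> ?N" for i
  proof -
    have "red ?N i \<in> {1..length w}" using red_in[OF _ that] card_compl_positions[OF assms(1)] by simp
    then have "letter w (red ?N i) \<in> set w" by (auto simp: letter_def)
    with assms(2) show ?thesis by auto
  qed
  have "filter (\<lambda>a. a \<noteq> f) (ins f n S w) =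
    map (\<lambda>i. if i \<in> S then f else letter w (red ?N i)) (filter (\<lambda>i. i \<notin> S) [1..<n + 1])"
    unfolding ins_def filter_map comp_def
    by (rule arg_cong[where f = "map _"], rule filter_cong) (use ne in \<open>auto simp del: upt_Suc\<close>)
  also have "\<dots> = map (\<lambda>i. letter w (red ?N i)) (sorted_list_of_set ?N)"
    unfolding filter_upt_sorted_list by (rule map_cong) auto
  also have "\<dots> = w"
    using map_letter_upt[of w] card_compl_positions[OF assms(1)] by (simp add: map_red_sorted_list)
  finally show ?thesis by (simp add: insertions_def ins_def)
qed

lemma ins_positions:
  assumes z: "z \<in> insertions f n w"
  defines "S \<equiv> {i \<in> {1..n}. letter z i = f}"
  shows "S \<in> positions n (length w)" "ins f n S w = z"
proof -
  let ?N = "{1..n} - S"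
  have len: "length z = n" and w: "filter (\<lambda>a. a \<noteq> f) z = w" using z by (auto simp: insertions_def)
  have "w = filter (\<lambda>a. a \<noteq> f) (map (letter z) [1..<n + 1])"
    using w map_letter_upt[of z] len by simp
  also have "\<dots> = map (letter z) (filter (\<lambda>i. i \<notin> S) [1..<n + 1])"
    unfolding filter_map comp_def
    by (rule arg_cong[where f = "map _"], rule filter_cong) (auto simp: S_def simp del: upt_Suc)
  finally have w': "w = map (letter z) (sorted_list_of_set ?N)" unfolding filter_upt_sorted_list .
  have "card ?N = length w" using w' by simp
  moreover have sub: "S \<subseteq> {1..n}" by (auto simp: S_def)
  moreover have "card S + card ?N = n"
    using sub by (metis card_atLeastAtMost card_Diff_subset card_mono diff_Suc_1 finite_atLeastAtMost
      finite_subset le_add_diff_inverse)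
  ultimately show positions: "S \<in> positions n (length w)" by (simp add: positions_def)
  have "letter w (red ?N i) = letter z i" if "i \<in> ?N" for i
  proof -
    have r: "red ?N i \<in> {1..card ?N}" using that by (intro red_in) auto
    have "letter w (red ?N i) = letter z (sorted_list_of_set ?N ! (red ?N i - 1))"
      unfolding w' letter_def[of "map _ _"] by (rule nth_map) (use r in auto)
    also have "sorted_list_of_set ?N ! (red ?N i - 1) = i" using that by (intro nth_red) auto
    finally show ?thesis .
  qed
  then have "ins f n S w = map (letter z) [1..<n + 1]"
    unfolding ins_def by (intro map_cong) (auto simp: S_def simp del: upt_Suc)
  then show "ins f n S w = z" using map_letter_upt[of z] len by simp
qed

text \<open>As f does not occur in w, the subset can be read off as the set of positions of
  f.\<close>

lemma bij_betw_ins: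
  assumes "f \<notin> set w"
  shows "bij_betw (\<lambda>S. ins f n S w) (positions n (length w)) (insertions f n w)"
proof (rule bij_betw_byWitness[where f' = "\<lambda>z. {i \<in> {1..n}. letter z i = f}"])
  show "\<forall>S\<in>positions n (length w). {i \<in> {1..n}. letter (ins f n S w) i = f} = S"
  proof
    fix S assume S: "S \<in> positions n (length w)"
    have "letter (ins f n S w) i = f \<longleftrightarrow> i \<in> S" if "i \<in> {1..n}" for i
    proof (cases "i \<in> S")
      case False
      then have "red ({1..n} - S) i \<in> {1..length w}"
        using red_in[of "{1..n} - S" i] card_compl_positions[OF S] that by simp
      then have "letter w (red ({1..n} - S) i) \<in> set w" by (auto simp: letter_def)
      with assms False that show ?thesis unfolding ins_def letter_map_upt[OF that] by auto
    qed (unfold ins_def letter_map_upt[OF that], simp)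
    with S show "{i \<in> {1..n}. letter (ins f n S w) i = f} = S" by (auto simp: positions_def)
  qed
  show "\<forall>z\<in>insertions f n w. ins f n {i \<in> {1..n}. letter z i = f} w = z"
    using ins_positions(2) by blast
  show "(\<lambda>S. ins f n S w) ` positions n (length w) \<subseteq> insertions f n w"
    using ins_in_insertions assms by blast
  show "(\<lambda>z. {i \<in> {1..n}. letter z i = f}) ` insertions f n w \<subseteq> positions n (length w)"
    using ins_positions(1) by blast
qed

lemma finite_insertions [simp]: "finite (insertions f n w)"
proof (rule finite_subset)
  show "insertions f n w \<subseteq> {z. set z \<subseteq> insert f (set w) \<and> length z = n}" by (auto simp: insertions_def)
qed (rule finite_lists_length_eq, simp)

text \<open>The descent set of a word of length n whose letters on S never descend between
  neighbours and lie below all others, while the letters off S form a word with descent set D. A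
  descent starts off S, and it ends in S or is inherited from D.\<close>

definition merged_DES :: "nat \<Rightarrow> nat set \<Rightarrow> nat set \<Rightarrow> nat set" where
  "merged_DES n S D = {i \<in> {1..<n}. i \<notin> S \<and> (Suc i \<in> S \<or> red ({1..n} - S) i \<in> D)}"

lemma merged_DES_empty: "D \<subseteq> {1..<n} \<Longrightarrow> merged_DES n {} D = D"
proof -
  assume "D \<subseteq> {1..<n}"
  moreover have "red {1..n} i = i" if "i \<in> {1..<n}" for i
  proof -
    have "{a \<in> {1..n}. a \<le> i} = {1..i}" using that by auto
    then show ?thesis by (simp add: red_def)
  qed
  ultimately show ?thesis by (auto simp: merged_DES_def)
qed

text \<open>Covers two instances: y is a word with zeros on S, or y is the inverse of a permutation
  that starts with the elements of S in increasing order.\<close>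

lemma merged_DES_eq:
  fixes y :: "nat \<Rightarrow> 'a :: linorder" and e :: "nat \<Rightarrow> 'b :: linorder"
  assumes S: "S \<in> positions n m"
    and in_S: "\<And>i. Suc i \<in> S \<Longrightarrow> i \<in> S \<Longrightarrow> y i \<le> y (Suc i)"
    and S_less: "\<And>i j. i \<in> S \<Longrightarrow> j \<in> {1..n} - S \<Longrightarrow> y i < y j"
    and off_S: "\<And>i j. i \<in> {1..n} - S \<Longrightarrow> j \<in> {1..n} - S \<Longrightarrow>
       y i < y j \<longleftrightarrow> e (red ({1..n} - S) i) < e (red ({1..n} - S) j)"
  shows "{i \<in> {1..<n}. y i > y (Suc i)} = merged_DES n S {j \<in> {1..<m}. e j > e (Suc j)}"
proof -
  let ?N = "{1..n} - S"
  have "y i > y (Suc i) \<longleftrightarrow> i \<notin> S \<and> (Suc i \<in> S \<or> red ?N i \<in> {j \<in> {1..<m}. e j > e (Suc j)})"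
    if i: "i \<in> {1..<n}" for i
  proof (cases "i \<in> S \<or> Suc i \<in> S")
    case True
    then show ?thesis
      using i in_S[of i] S_less[of i "Suc i"] S_less[of "Suc i" i] by (auto simp: not_less dest: leD less_imp_le)
  next
    case False
    then have N: "i \<in> ?N" "Suc i \<in> ?N" using i by auto
    \<comment> \<open>If i and \<open>Suc i\<close> are both off S, they have consecutive ranks, so
      a descent at i is a descent of the subword.\<close>
    have "red ?N (Suc i) = Suc (red ?N i)" using N by (intro red_Suc) auto
    moreover have "red ?N (Suc i) \<in> {1..m}" "red ?N i \<in> {1..m}"
      using red_in[OF _ N(2)] red_in[OF _ N(1)] card_compl_positions[OF S] by auto
    ultimately show ?thesis using False off_S[OF N(2) N(1)] by auto
  qed
  then show ?thesis by (auto simp: merged_DES_def)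
qed

lemma DES_ins_zero:
  assumes "S \<in> positions n (length w)" "0 \<notin> set w"
  shows "DES_word (ins 0 n S w) = merged_DES n S (DES_word w)"
proof -
  have "letter w (red ({1..n} - S) i) \<noteq> 0" if "i \<in> {1..n} - S" for i
  proof -
    have "red ({1..n} - S) i \<in> {1..length w}" using red_in[OF _ that] card_compl_positions[OF assms(1)] by simp
    then have "letter w (red ({1..n} - S) i) \<in> set w" by (auto simp: letter_def)
    with assms(2) show ?thesis by metis
  qed
  then show ?thesis
    unfolding ins_def DES_map_upt unfolding DES_word_def Suc_eq_plus1[symmetric]
    by (intro merged_DES_eq[OF assms(1)]) auto
qed

subsection \<open>Descents of shuffles\<close>

lemma DES_append:
  "DES_word (xs @ ys) = DES_word xs \<union> {i. i = length xs \<and> xs \<noteq> [] \<and> ys \<noteq> [] \<and> last xs > hd ys} \<union>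
     (\<lambda>i. length xs + i) ` DES_word ys"
proof -
  have "i \<in> DES_word (xs @ ys) \<longleftrightarrow> i \<in> DES_word xs \<or> (i = length xs \<and> xs \<noteq> [] \<and> ys \<noteq> [] \<and> last xs > hd ys) \<or>
     (i > length xs \<and> i - length xs \<in> DES_word ys)" for i
  proof -
    consider "i = 0" | "i \<ge> 1" "i < length xs" | "i = length xs" "xs \<noteq> []" | "i > length xs" by (cases "xs = []") force+
    then show ?thesis
    proof cases
      case 3
      then show ?thesis by (auto simp: DES_word_def letter_def nth_append last_conv_nth hd_conv_nth Suc_le_eq)
    next
      case 4
      then obtain j where "i = length xs + Suc j" using less_iff_Suc_add by auto
      then show ?thesis by (auto simp: DES_word_def letter_def nth_append)
    qed (auto simp: DES_word_def letter_def nth_append)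
  qed
  moreover have "(i > length xs \<and> i - length xs \<in> DES_word ys) = (i \<in> (\<lambda>i. length xs + i) ` DES_word ys)" for i
  proof
    assume "i > length xs \<and> i - length xs \<in> DES_word ys"
    then show "i \<in> (\<lambda>i. length xs + i) ` DES_word ys" by (intro image_eqI[of _ _ "i - length xs"]) auto
  qed (auto simp: DES_word_def)
  ultimately show ?thesis by blast
qed

lemma DES_empty_iff_sorted: "DES_word w = {} \<longleftrightarrow> sorted w"
proof -
  have "w ! i \<le> w ! Suc i" if "DES_word w = {}" "Suc i < length w" for i
    using that(2) equals0D[OF that(1), of "Suc i"] by (simp add: DES_word_def not_less)
  moreover have "DES_word w = {}" if mono: "\<And>i. Suc i < length w \<Longrightarrow> w ! i \<le> w ! Suc i"
  proof -
    have "\<not> letter w j > letter w (j + 1)" if "j \<in> {1..<length w}" for j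
      using that mono[of "j - 1"] by (simp add: letter_def not_less)
    then show ?thesis by (auto simp: DES_word_def)
  qed
  ultimately show ?thesis unfolding sorted_iff_nth_Suc by blast
qed

lemma DES_take: "DES_word (take i w) = DES_word w \<inter> {..<i}"
  by (auto simp: DES_word_def letter_def)

lemma DES_drop: "DES_word (drop i w) = {j. 0 < j \<and> i + j \<in> DES_word w}"
  by (auto simp: DES_word_def letter_def)

text \<open>A sorted word is determined by its multiset of letters, here that of w together with
  \<open>n - length w\<close> copies of f; and a subword of a sorted word is sorted.\<close>

lemma card_sorted_insertions:
  assumes "f \<notin> set w"
  shows "card {z \<in> insertions f n w. sorted z} = (if sorted w \<and> length w \<le> n then 1 else 0)"
proof (cases "sorted w \<and> length w \<le> n")
  case True
  let ?M = "mset w + replicate_mset (n - length w) f"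
  have "{z \<in> insertions f n w. sorted z} = {sorted_list_of_multiset ?M}"
  proof (intro equalityI subsetI)
    fix z assume "z \<in> {z \<in> insertions f n w. sorted z}"
    then have z: "length z = n" "filter (\<lambda>a. a \<noteq> f) z = w" "sorted z" by (auto simp: insertions_def)
    have *: "mset z = filter_mset (\<lambda>a. a \<noteq> f) (mset z) + filter_mset (\<lambda>a. \<not> a \<noteq> f) (mset z)"
      by (rule multiset_partition)
    have "filter_mset (\<lambda>a. \<not> a \<noteq> f) (mset z) = replicate_mset (count (mset z) f) f"
      by (simp add: filter_eq_replicate_mset)
    with * z(2) have m: "mset z = mset w + replicate_mset (count (mset z) f) f" by (metis mset_filter)
    then have "size (mset z) = length w + count (mset z) f" by (metis size_mset size_union size_replicate_mset)
    then have "count (mset z) f = n - length w" using z(1) by simp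
    with m have "mset z = ?M" by simp
    then show "z \<in> {sorted_list_of_multiset ?M}"
      using z(3) by (metis sorted_list_of_multiset_mset singletonI sorted_sort_id)
  next
    fix z assume "z \<in> {sorted_list_of_multiset ?M}"
    then have zM: "z = sorted_list_of_multiset ?M" by simp
    then have m: "mset z = ?M" "sorted z" by auto
    have "filter (\<lambda>a. a \<noteq> f) z = w"
    proof (rule properties_for_sort[symmetric, of "filter (\<lambda>a. a \<noteq> f) z" w, THEN trans])
      have "filter_mset (\<lambda>a. a \<noteq> f) (mset w) = mset w"
        using assms by (auto simp: filter_mset_eq_conv)
      then show "mset (filter (\<lambda>a. a \<noteq> f) z) = mset w" using m(1) by (simp add: filter_mset_eq_mempty_iff)
      show "sorted (filter (\<lambda>a. a \<noteq> f) z)" using m(2) by (rule sorted_wrt_filter)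
      show "sort w = w" using True by (simp add: sorted_sort_id)
    qed
    moreover have "length z = n" using arg_cong[OF m(1), of size] True by simp
    ultimately show "z \<in> {z \<in> insertions f n w. sorted z}" using m(2) by (simp add: insertions_def)
  qed
  with True show ?thesis by simp
next
  case False
  have "{z \<in> insertions f n w. sorted z} = {}"
    using False by (auto simp: insertions_def sorted_wrt_filter intro: le_trans[OF length_filter_le])
  with False show ?thesis by (simp only:) simp
qed

text \<open>Let b be the largest element of J below n, or 0. The last n - b letters of a word
  whose descents lie in J are sorted, which leaves one place for the copies of f among them.\<close>

lemma card_insertions_DES_subset_eq:
  assumes "f \<notin> set w" "g \<notin> set v" "length w = length v" "DES_word w = DES_word v"
  shows "card {z \<in> insertions f n w. DES_word z \<subseteq> J} = card {z \<in> insertions g n v. DES_word z \<subseteq> J}"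
  using assms
proof (induction n arbitrary: w v rule: less_induct)
  case (less n)
  show ?case
  proof (cases "n = 0")
    case True
    then have empty: "{z \<in> insertions h n u. DES_word z \<subseteq> J} = (if u = [] then {[]} else {})" for h u
      by (auto simp: insertions_def DES_word_def)
    have "w = [] \<longleftrightarrow> v = []" using less.prems(3) by auto
    then show ?thesis unfolding empty by simp
  next
    case False
    define b where "b = Max (insert 0 (J \<inter> {1..<n}))"
    have "b \<in> insert 0 (J \<inter> {1..<n})" unfolding b_def by (rule Max_in) auto
    with False have b: "b < n" "b = 0 \<or> b \<in> J" by auto
    have gap: "i \<le> b" if "i \<in> J" "i \<in> {1..<n}" for i
      unfolding b_def using that by (intro Max_ge) auto
    \<comment> \<open>No position strictly between b and n lies in J, so the right part may not
      descend. The junction at b is harmless, because b is 0 or belongs to J.\<close>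
    have split: "DES_word (x @ y) \<subseteq> J \<longleftrightarrow> DES_word x \<subseteq> J \<and> sorted y"
      if "length x = b" "length y = n - b" for x y
    proof -
      have "(\<lambda>i. b + i) ` DES_word y \<subseteq> J \<longleftrightarrow> DES_word y = {}"
      proof
        assume sub: "(\<lambda>i. b + i) ` DES_word y \<subseteq> J"
        have "False" if i: "i \<in> DES_word y" for i
        proof -
          have "b + i \<in> J" using i sub by blast
          moreover have "0 < i" "b + i < n" using i \<open>length y = n - b\<close> by (auto simp: DES_word_def)
          ultimately show False using gap[of "b + i"] by simp
        qed
        then show "DES_word y = {}" by blast
      qed simp
      with that b(2) show ?thesis unfolding DES_append DES_empty_iff_sorted[symmetric] by auto
    qed
    \<comment> \<open>Each word is cut at b, and i is the number of letters of u in its left part.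
      There is at most one sorted right part, and whether it exists depends only on the length and
      the descents of \<open>drop i u\<close>.\<close>
    have count: "card {z \<in> insertions h n u. DES_word z \<subseteq> J} =
      (\<Sum>i\<le>length u. card {x \<in> insertions h b (take i u). DES_word x \<subseteq> J} *
         (if DES_word (drop i u) = {} \<and> length u - i \<le> n - b then 1 else 0))" if "h \<notin> set u" for h u
    proof -
      let ?P = "\<lambda>i. {x \<in> insertions h b (take i u). DES_word x \<subseteq> J} \<times> {y \<in> insertions h (n - b) (drop i u). sorted y}"
      have "bij_betw (\<lambda>(i, x, y). x @ y) (Sigma {..length u} ?P) {z \<in> insertions h n u. DES_word z \<subseteq> J}"
      proof (rule bij_betw_byWitness[where
            f' = "\<lambda>z. (length (filter (\<lambda>a. a \<noteq> h) (take b z)), take b z, drop b z)"])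
        show "\<forall>p\<in>Sigma {..length u} ?P. (\<lambda>z. (length (filter (\<lambda>a. a \<noteq> h) (take b z)), take b z, drop b z))
               ((\<lambda>(i, x, y). x @ y) p) = p"
          by (auto simp: insertions_def)
        show "\<forall>z\<in>{z \<in> insertions h n u. DES_word z \<subseteq> J}. (\<lambda>(i, x, y). x @ y)
            (length (filter (\<lambda>a. a \<noteq> h) (take b z)), take b z, drop b z) = z"
          by auto
        show "(\<lambda>(i, x, y). x @ y) ` Sigma {..length u} ?P \<subseteq> {z \<in> insertions h n u. DES_word z \<subseteq> J}"
        proof safe
          fix i x y assume x: "x \<in> insertions h b (take i u)" "DES_word x \<subseteq> J"
            and y: "y \<in> insertions h (n - b) (drop i u)" "sorted y"
          have l: "length x = b" "length y = n - b" using x y by (auto simp: insertions_def)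
          show "x @ y \<in> insertions h n u" using x y b(1) by (auto simp: insertions_def)
          show "j \<in> J" if "j \<in> DES_word (x @ y)" for j using that split[OF l] x y by blast
        qed
        show "(\<lambda>z. (length (filter (\<lambda>a. a \<noteq> h) (take b z)), take b z, drop b z)) `
            {z \<in> insertions h n u. DES_word z \<subseteq> J} \<subseteq> Sigma {..length u} ?P"
        proof
          fix p assume "p \<in> (\<lambda>z. (length (filter (\<lambda>a. a \<noteq> h) (take b z)), take b z, drop b z)) `
            {z \<in> insertions h n u. DES_word z \<subseteq> J}"
          then obtain z where z: "length z = n" "filter (\<lambda>a. a \<noteq> h) z = u" "DES_word z \<subseteq> J"
            and p: "p = (length (filter (\<lambda>a. a \<noteq> h) (take b z)), take b z, drop b z)"
            by (auto simp: insertions_def)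
          have u: "u = filter (\<lambda>a. a \<noteq> h) (take b z) @ filter (\<lambda>a. a \<noteq> h) (drop b z)"
            using z(2) by (metis append_take_drop_id filter_append)
          have "DES_word (take b z) \<subseteq> J \<and> sorted (drop b z)"
            using split[of "take b z" "drop b z"] z b(1) by simp
          then show "p \<in> Sigma {..length u} ?P" unfolding p by (auto simp: u insertions_def z(1) b(1) less_imp_le)
        qed
      qed
      then have "card {z \<in> insertions h n u. DES_word z \<subseteq> J} = card (Sigma {..length u} ?P)"
        by (simp add: bij_betw_same_card)
      also have "\<dots> = (\<Sum>i\<le>length u. card (?P i))" by (rule card_SigmaI) auto
      also have "\<dots> = (\<Sum>i\<le>length u. card {x \<in> insertions h b (take i u). DES_word x \<subseteq> J} *
         (if DES_word (drop i u) = {} \<and> length u - i \<le> n - b then 1 else 0))"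
      proof (rule sum.cong[OF refl])
        fix i
        have "h \<notin> set (drop i u)" using that by (auto dest: in_set_dropD)
        then show "card (?P i) = card {x \<in> insertions h b (take i u). DES_word x \<subseteq> J} *
            (if DES_word (drop i u) = {} \<and> length u - i \<le> n - b then 1 else 0)"
          unfolding card_cartesian_product card_sorted_insertions[OF \<open>h \<notin> set (drop i u)\<close>] DES_empty_iff_sorted by simp
      qed
      finally show ?thesis .
    qed
    \<comment> \<open>The left parts have length b < n, and their subwords again have equal lengths
      and descents.\<close>
    have "card {x \<in> insertions f b (take i w). DES_word x \<subseteq> J} = card {x \<in> insertions g b (take i v). DES_word x \<subseteq> J}" for i
      using less.prems by (intro less.IH b(1)) (auto simp: DES_take dest: in_set_takeD)
    moreover have "DES_word (drop i w) = DES_word (drop i v)" for i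
      using less.prems by (simp add: DES_drop)
    ultimately show ?thesis using count[OF less.prems(1)] count[OF less.prems(2)] less.prems(3) by simp
  qed
qed

lemma distr_DES_ins_eq:
  assumes "f \<notin> set w" "g \<notin> set v" "length w = length v" "DES_word w = DES_word v"
  shows "distr (\<lambda>S. DES_word (ins f n S w)) (positions n (length w)) =
         distr (\<lambda>S. DES_word (ins g n S v)) (positions n (length v))"
proof -
  have "distr DES_word (insertions f n w) = distr DES_word (insertions g n v)"
    by (rule distr_eq_if_subset_counts_eq) (auto intro: card_insertions_DES_subset_eq[OF assms])
  then show ?thesis
    using distr_bij_betw[OF bij_betw_ins[OF assms(1)]] distr_bij_betw[OF bij_betw_ins[OF assms(2)]] by metis
qed

subsection \<open>The major index of shuffles\<close>

text \<open>For a finite set S of positive numbers this is the sum of the differences between its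
  elements and their ranks. It is the contribution of the subset to \<open>maf\<close> and
  \<open>mag\<close>, and by \<open>card_inversions_across\<close> to the inversions.\<close>

definition excess :: "nat set \<Rightarrow> nat" where
  "excess S = \<Sum>S - (\<Sum>i=1..card S. i)"

text \<open>Multiplication by \<open>q^a\<close> of a polynomial in q that is given as the multiset
  of its exponents.\<close>

definition shift :: "nat \<Rightarrow> nat multiset \<Rightarrow> nat multiset" where
  "shift a M = image_mset (\<lambda>x. a + x) M"

lemma shift_empty [simp]: "shift a {#} = {#}"
  and shift_single [simp]: "shift a {#x#} = {#a + x#}"
  and shift_add_mset [simp]: "shift a (add_mset x M) = add_mset (a + x) (shift a M)"
  and shift_add [simp]: "shift a (M + N) = shift a M + shift a N"
  and shift_shift [simp]: "shift a (shift b M) = shift (a + b) M"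
  and shift_0 [simp]: "shift 0 M = M"
  by (simp_all add: shift_def multiset.map_comp comp_def add.assoc)

lemma distr_add_const: "distr (\<lambda>x. a + f x) A = shift a (distr f A)"
  by (simp add: shift_def image_mset_distr)

text \<open>The q-binomial coefficient m + k over k, as the multiset of exponents of q.\<close>

fun qbinom :: "nat \<Rightarrow> nat \<Rightarrow> nat multiset" where
  "qbinom 0 k = {#0#}"
| "qbinom (Suc m) 0 = {#0#}"
| "qbinom (Suc m) (Suc k) = shift (Suc m) (qbinom (Suc m) k) + qbinom m (Suc k)"

lemma qbinom_0_right [simp]: "qbinom m 0 = {#0#}"
  by (cases m) auto

text \<open>The second q-Pascal rule. In the main case the left side is expanded by the defining
  recursion and then by the induction hypothesis, and the terms of the right side by the defining
  recursion; the same four terms appear.\<close>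

lemma qbinom_dual: "qbinom (Suc m) (Suc k) = qbinom (Suc m) k + shift (Suc k) (qbinom m (Suc k))"
proof (induction "m + k" arbitrary: m k rule: less_induct)
  case less
  consider "m = 0" "k = 0" | k' where "m = 0" "k = Suc k'" | m' where "m = Suc m'" "k = 0"
    | m' k' where "m = Suc m'" "k = Suc k'" by (cases m; cases k) auto
  then show ?case
  proof cases
    case 2
    then show ?thesis using arg_cong[OF less(1)[of 0 k'], of "shift 1"] less(1)[of 0 k'] by (simp add: ac_simps)
  next
    case 3
    then show ?thesis using arg_cong[OF less(1)[of m' 0], of "shift 1"] less(1)[of m' 0] by (simp add: ac_simps)
  next
    case 4
    have "qbinom (Suc m) k = qbinom (Suc m) k' + shift k (qbinom m k)"
      using less[of m k'] 4 by simp
    moreover have "qbinom m (Suc k) = qbinom m k + shift (Suc k) (qbinom m' (Suc k))"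
      using less[of m' k] 4 by simp
    moreover have "qbinom (Suc m) k = shift (Suc m) (qbinom (Suc m) k') + qbinom m k"
      and "qbinom m (Suc k) = shift m (qbinom m k) + qbinom m' (Suc k)"
      using 4 by simp_all
    ultimately have "qbinom (Suc m) (Suc k) = shift (Suc m) (qbinom (Suc m) k' + shift k (qbinom m k)) +
        (qbinom m k + shift (Suc k) (qbinom m' (Suc k)))"
      and "qbinom (Suc m) k + shift (Suc k) (qbinom m (Suc k)) =
        (shift (Suc m) (qbinom (Suc m) k') + qbinom m k) + shift (Suc k) (shift m (qbinom m k) + qbinom m' (Suc k))"
      by (metis qbinom.simps(3), metis)
    then show ?thesis by (simp add: ac_simps)
  qed simp
qed

text \<open>The new element is the largest and has rank \<open>Suc (card S)\<close>, so it adds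
  \<open>Suc n - Suc (card S)\<close>, which is m.\<close>

lemma excess_insert:
  assumes "S \<subseteq> {1..n}" "card S + m = n"
  shows "excess (insert (Suc n) S) = m + excess S"
proof -
  have fin: "finite S" "Suc n \<notin> S" using assms finite_subset by auto
  have "0 \<notin> S" using assms by auto
  then have "(\<Sum>i=1..card S. i) \<le> \<Sum>S" using sum_upto_card_le fin by blast
  with fin assms(2) show ?thesis by (simp add: excess_def)
qed

text \<open>Whether the largest position belongs to S decides between the two summands in the
  recursion of \<open>qbinom\<close>.\<close>

lemma distr_excess: "distr excess (positions (m + k) m) = qbinom m k"
proof (induction m k rule: qbinom.induct)
  case (1 k)
  have "positions (0 + k) 0 = {{1..k}}"
  proof (intro equalityI subsetI)
    fix S assume "S \<in> positions (0 + k) 0"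
    then have "S \<subseteq> {1..k}" "card S = card {1..k}" by (auto simp: positions_def)
    then show "S \<in> {{1..k}}" by (simp add: card_subset_eq)
  qed (auto simp: positions_def)
  then show ?case by (simp add: excess_def)
next
  case (2 m)
  then show ?case by (simp add: excess_def)
next
  case (3 m k)
  let ?n = "Suc m + k"
  have fin: "finite S" "Suc ?n \<notin> S" if "S \<subseteq> {1..?n}" for S
    using that finite_subset by auto
  have sp: "positions (Suc m + Suc k) (Suc m) = insert (Suc ?n) ` positions ?n (Suc m) \<union> positions ?n m"
  proof (intro equalityI subsetI)
    fix S assume S: "S \<in> positions (Suc m + Suc k) (Suc m)"
    show "S \<in> insert (Suc ?n) ` positions ?n (Suc m) \<union> positions ?n m"
    proof (cases "Suc ?n \<in> S")
      case True
      then have "card S = Suc (card (S - {Suc ?n}))"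
        using S by (intro card.remove) (auto simp: positions_def intro: finite_subset)
      moreover have "S - {Suc ?n} \<subseteq> {1..?n}" using S by (fastforce simp: positions_def le_Suc_eq)
      ultimately have "S - {Suc ?n} \<in> positions ?n (Suc m)" using S by (auto simp: positions_def)
      then show ?thesis using True by (auto intro!: image_eqI[of _ _ "S - {Suc ?n}"])
    next
      case False
      have "S \<subseteq> {1..?n}"
      proof
        fix x assume "x \<in> S"
        moreover from this have "x \<in> {1..Suc ?n}" using S by (auto simp: positions_def)
        ultimately show "x \<in> {1..?n}" using False by (auto simp: le_Suc_eq)
      qed
      then show ?thesis using S by (auto simp: positions_def)
    qed
  next
    fix S assume "S \<in> insert (Suc ?n) ` positions ?n (Suc m) \<union> positions ?n m"
    then show "S \<in> positions (Suc m + Suc k) (Suc m)"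
    proof
      assume "S \<in> insert (Suc ?n) ` positions ?n (Suc m)"
      then obtain R where R: "R \<subseteq> {1..?n}" "card R + Suc m = ?n" "S = insert (Suc ?n) R" by (auto simp: positions_def)
      with fin[OF R(1)] show ?thesis by (auto simp: positions_def)
    next
      assume "S \<in> positions ?n m"
      then show ?thesis by (force simp: positions_def)
    qed
  qed
  have "distr excess (positions (Suc m + Suc k) (Suc m)) =
    distr excess (insert (Suc ?n) ` positions ?n (Suc m)) + distr excess (positions ?n m)"
    unfolding sp by (rule distr_Un) (auto simp: positions_def)
  also have "distr excess (insert (Suc ?n) ` positions ?n (Suc m)) =
    distr (\<lambda>S. excess (insert (Suc ?n) S)) (positions ?n (Suc m))"
  proof (rule distr_image)
    show "inj_on (insert (Suc ?n)) (positions ?n (Suc m))"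
      using fin(2) by (intro inj_onI) (metis (no_types, lifting) positions_def insert_ident mem_Collect_eq)
  qed
  also have "\<dots> = distr (\<lambda>S. Suc m + excess S) (positions ?n (Suc m))"
    by (rule distr_cong, rule excess_insert) (auto simp: positions_def)
  also have "\<dots> = shift (Suc m) (distr excess (positions ?n (Suc m)))" by (rule distr_add_const)
  finally show ?case using 3 by simp
qed

lemma maj_word_snoc:
  "maj_word (z @ [c]) = maj_word z + (if z \<noteq> [] \<and> last z > c then length z else 0)"
proof -
  have "DES_word (z @ [c]) = DES_word z \<union> (if z \<noteq> [] \<and> last z > c then {length z} else {})"
    unfolding DES_append by (auto simp: DES_word_def)
  moreover have "length z \<notin> DES_word z" by (simp add: DES_word_def)
  ultimately show ?thesis by (simp add: maj_word_def)
qed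

text \<open>Words ending in 0 are kept apart from words ending in a letter of w, because the last
  letter decides whether an appended letter creates a descent. With this separation the induction
  closes by the two q-Pascal rules; k is the number of zeros.\<close>

lemma distr_maj_insertions_last:
  assumes "0 \<notin> set w" "length w + k = n"
  shows "distr maj_word {z \<in> insertions 0 n w. z \<noteq> [] \<and> last z = 0} =
           (if k = 0 then {#} else shift (maj_word w + length w) (qbinom (length w) (k - 1))) \<and>
         distr maj_word {z \<in> insertions 0 n w. z \<noteq> [] \<and> last z \<noteq> 0} =
           (if w = [] then {#} else shift (maj_word w) (qbinom (length w - 1) k))"
  using assms
proof (induction n arbitrary: w k)
  case 0
  have empty: "{z \<in> insertions 0 0 w. z \<noteq> [] \<and> P z} = {}" for P by (auto simp: insertions_def)
  from 0 show ?case unfolding empty by simp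
next
  case (Suc n)
  define A where "A m u = {z \<in> insertions 0 m u. z \<noteq> [] \<and> last z = 0}" for m u
  define B where "B m u = {z \<in> insertions 0 m u. z \<noteq> [] \<and> last z \<noteq> 0}" for m u
  have AB: "insertions 0 n u = A n u \<union> B n u" "A n u \<inter> B n u = {}" if "n \<noteq> 0" for u
    using that by (auto simp: A_def B_def insertions_def)
  have fin: "finite (A n u)" "finite (B n u)" for u by (auto simp: A_def B_def)
  have Zd0: "n = 0 \<Longrightarrow> insertions 0 n u = (if u = [] then {[]} else {})" for u by (auto simp: insertions_def)
  have "distr maj_word (A (Suc n) w) =
    (if k = 0 then {#} else shift (maj_word w + length w) (qbinom (length w) (k - 1)))"
  proof (cases k)
    case 0
    have "A (Suc n) w = {}"
    proof -
      have False if "z \<in> insertions 0 (Suc n) w" "z \<noteq> []" "last z = 0" for z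
      proof -
        have "length (filter (\<lambda>a. a \<noteq> 0) z) < length z"
          by (rule length_filter_less[of "last z"]) (use that(2,3) last_in_set[OF that(2)] in simp_all)
        with that Suc.prems(2) 0 show False by (auto simp: insertions_def)
      qed
      then show ?thesis by (auto simp: A_def)
    qed
    with 0 show ?thesis by simp
  next
    case (Suc k')
    \<comment> \<open>Deleting the final 0 leaves an arbitrary shuffle of w with one zero less. The
      deleted 0 created a descent, at n, exactly if it followed a nonzero letter.\<close>
    have "A (Suc n) w = (\<lambda>z. z @ [0]) ` insertions 0 n w"
    proof (intro equalityI subsetI)
      fix z assume "z \<in> A (Suc n) w"
      then show "z \<in> (\<lambda>z. z @ [0]) ` insertions 0 n w"
        by (cases z rule: rev_cases) (auto simp: A_def insertions_def)
    qed (auto simp: A_def insertions_def)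
    then have "distr maj_word (A (Suc n) w) = distr (\<lambda>z. maj_word (z @ [0])) (insertions 0 n w)"
      by (simp add: distr_image inj_on_def)
    also have "\<dots> = shift (maj_word w + length w) (qbinom (length w) k')"
    proof (cases "n = 0")
      case True
      then have "w = []" "k' = 0" using Suc.prems(2) Suc by auto
      then show ?thesis using maj_word_snoc[of "[]" 0] unfolding Zd0[OF True] by simp
    next
      case False
      have "distr (\<lambda>z. maj_word (z @ [0])) (insertions 0 n w) =
        distr (\<lambda>z. maj_word (z @ [0])) (A n w) + distr (\<lambda>z. maj_word (z @ [0])) (B n w)"
        unfolding AB(1)[OF False] using fin AB(2)[OF False] by (intro distr_Un)
      also have "distr (\<lambda>z. maj_word (z @ [0])) (A n w) = distr maj_word (A n w)"
        by (rule distr_cong) (auto simp: A_def maj_word_snoc)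
      also have "distr (\<lambda>z. maj_word (z @ [0])) (B n w) = distr (\<lambda>z. n + maj_word z) (B n w)"
        by (rule distr_cong) (auto simp: B_def insertions_def maj_word_snoc)
      also have "\<dots> = shift n (distr maj_word (B n w))" by (rule distr_add_const)
      finally have *: "distr (\<lambda>z. maj_word (z @ [0])) (insertions 0 n w) =
        (if k' = 0 then {#} else shift (maj_word w + length w) (qbinom (length w) (k' - 1))) +
        shift n (if w = [] then {#} else shift (maj_word w) (qbinom (length w - 1) k'))"
        using Suc.IH[of w k'] Suc.prems Suc unfolding A_def B_def by simp
      show ?thesis
      proof (cases w)
        case Nil
        with * False Suc Suc.prems show ?thesis by simp
      next
        case (Cons x w')
        with * Suc Suc.prems(2) show ?thesis
          by (cases k') (auto simp: qbinom_dual ac_simps simp del: qbinom.simps(3))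
      qed
    qed
    finally show ?thesis using Suc by simp
  qed
  moreover have "distr maj_word (B (Suc n) w) = (if w = [] then {#} else shift (maj_word w) (qbinom (length w - 1) k))"
  proof (cases w rule: rev_cases)
    case Nil
    have "B (Suc n) w = {}"
      unfolding B_def Nil insertions_def by (auto simp: filter_empty_conv dest: last_in_set)
    with Nil show ?thesis by simp
  next
    case (snoc w' x)
    have x: "x \<noteq> 0" "0 \<notin> set w'" and len: "length w' + k = n" using Suc.prems snoc by auto
    \<comment> \<open>A final nonzero letter is the last letter x of w; deleting it leaves a shuffle
      of w' with the same number of zeros.\<close>
    have "B (Suc n) w = (\<lambda>z. z @ [x]) ` insertions 0 n w'"
    proof (intro equalityI subsetI)
      fix z assume "z \<in> B (Suc n) w"
      then show "z \<in> (\<lambda>z. z @ [x]) ` insertions 0 n w'"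
        using snoc by (cases z rule: rev_cases) (auto simp: B_def insertions_def)
    qed (use snoc x in \<open>auto simp: B_def insertions_def\<close>)
    then have "distr maj_word (B (Suc n) w) = distr (\<lambda>z. maj_word (z @ [x])) (insertions 0 n w')"
      by (simp add: distr_image inj_on_def)
    also have "\<dots> = shift (maj_word w) (qbinom (length w') k)"
    proof (cases "n = 0")
      case True
      then have "w' = []" "k = 0" using len by auto
      then show ?thesis using snoc unfolding Zd0[OF True] by simp
    next
      case False
      \<comment> \<open>After a zero, x creates no descent; after a letter of w' it creates one
        exactly if \<open>?d\<close> holds. When both parts occur, they recombine by
        \<open>qbinom_dual\<close> if \<open>?d\<close> holds and by the defining recursion
        otherwise.\<close>
      let ?d = "w' \<noteq> [] \<and> last w' > x"
      have last: "last z = last w' \<and> w' \<noteq> []" if "z \<in> B n w'" for z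
        using that by (cases z rule: rev_cases) (auto simp: B_def insertions_def)
      have "distr (\<lambda>z. maj_word (z @ [x])) (insertions 0 n w') =
        distr (\<lambda>z. maj_word (z @ [x])) (A n w') + distr (\<lambda>z. maj_word (z @ [x])) (B n w')"
        unfolding AB(1)[OF False] using fin AB(2)[OF False] by (intro distr_Un)
      also have "distr (\<lambda>z. maj_word (z @ [x])) (A n w') = distr maj_word (A n w')"
        by (rule distr_cong) (auto simp: A_def maj_word_snoc)
      also have "distr (\<lambda>z. maj_word (z @ [x])) (B n w') = distr (\<lambda>z. (if ?d then n else 0) + maj_word z) (B n w')"
        using last by (intro distr_cong) (auto simp: B_def insertions_def maj_word_snoc)
      also have "\<dots> = shift (if ?d then n else 0) (distr maj_word (B n w'))" by (rule distr_add_const)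
      finally have *: "distr (\<lambda>z. maj_word (z @ [x])) (insertions 0 n w') =
        (if k = 0 then {#} else shift (maj_word w' + length w') (qbinom (length w') (k - 1))) +
        shift (if ?d then n else 0) (if w' = [] then {#} else shift (maj_word w') (qbinom (length w' - 1) k))"
        using Suc.IH[OF x(2) len] unfolding A_def B_def by simp
      have maj: "maj_word w = maj_word w' + (if ?d then length w' else 0)"
        unfolding snoc maj_word_snoc ..
      show ?thesis
      proof (cases w')
        case Nil
        with * False len maj show ?thesis by simp
      next
        case (Cons y w'')
        show ?thesis
        proof (cases k)
          case 0
          with * Cons len maj show ?thesis by (auto simp: ac_simps)
        next
          case (Suc k')
          show ?thesis
          proof (cases ?d)
            case True
            then show ?thesis unfolding * maj using Cons Suc len[symmetric]
              by (simp add: qbinom_dual ac_simps del: qbinom.simps(3))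
          next
            case False
            then show ?thesis unfolding * maj using Cons Suc len by (auto simp: ac_simps)
          qed
        qed
      qed
    qed
    finally show ?thesis using snoc by simp
  qed
  ultimately show ?case unfolding A_def B_def by simp
qed

text \<open>Both sides are a q-binomial distribution shifted by \<open>maj_word w\<close>: on the
  left the words ending in 0 and the others add up by the recursion of \<open>qbinom\<close>, on the
  right this is \<open>distr_excess\<close>.\<close>

lemma distr_maj_merged_DES:
  assumes "0 \<notin> set w" "length w \<le> n"
  shows "distr (\<lambda>S. \<Sum>(merged_DES n S (DES_word w))) (positions n (length w)) =
         distr (\<lambda>S. excess S + maj_word w) (positions n (length w))"
proof -
  obtain k where k: "length w + k = n" using assms(2) le_Suc_ex by blast
  let ?A = "{z \<in> insertions 0 n w. z \<noteq> [] \<and> last z = 0}" and ?B = "{z \<in> insertions 0 n w. z \<noteq> [] \<and> last z \<noteq> 0}"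
  have "distr maj_word (insertions 0 n w) = shift (maj_word w) (qbinom (length w) k)"
  proof (cases "n = 0")
    case True
    then have "w = []" "k = 0" "insertions 0 n w = {[]}" using k by (auto simp: insertions_def)
    then show ?thesis by simp
  next
    case False
    then have "insertions 0 n w = ?A \<union> ?B" by (auto simp: insertions_def)
    then have "distr maj_word (insertions 0 n w) = distr maj_word ?A + distr maj_word ?B"
      by (metis (no_types, lifting) distr_Un finite_Un finite_insertions disjoint_iff mem_Collect_eq)
    then show ?thesis
      using distr_maj_insertions_last[OF assms(1) k] False k by (cases w; cases k) (auto simp: ac_simps)
  qed
  also have "\<dots> = distr (\<lambda>S. maj_word w + excess S) (positions n (length w))"
    unfolding distr_add_const using distr_excess[of "length w" k] k by simp
  finally show ?thesis
    unfolding distr_bij_betw[OF bij_betw_ins[OF assms(1)]]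
    using distr_cong[of "positions n (length w)" "\<lambda>S. maj_word (ins 0 n S w)" "\<lambda>S. \<Sum>(merged_DES n S (DES_word w))"]
      DES_ins_zero[OF _ assms(1)]
    by (simp add: maj_word_def add.commute)
qed

subsection \<open>Permutations as words\<close>

definition perm_words :: "nat list set" where
  "perm_words = {w. distinct w \<and> set w = {1..length w}}"

lemma finite_perm_words: "finite {w. w \<in> perm_words \<and> P w \<and> length w \<le> n}"
proof (rule finite_subset)
  show "{w. w \<in> perm_words \<and> P w \<and> length w \<le> n} \<subseteq> {w. set w \<subseteq> {1..n} \<and> length w \<le> n}"
    by (auto simp: perm_words_def)
qed (rule finite_lists_length_le, simp)

lemma zero_notin_perm_word: "w \<in> perm_words \<Longrightarrow> 0 \<notin> set w"
  by (simp add: perm_words_def)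

lemma letter_image: "letter w ` {1..length w} = set w"
proof -
  have "{1..length w} = Suc ` {..<length w}" by (auto simp: image_iff Suc_le_eq gr0_conv_Suc)
  then show ?thesis by (auto simp: image_image set_conv_nth)
qed

lemma bij_betw_letter:
  assumes "w \<in> perm_words"
  shows "bij_betw (letter w) {1..length w} {1..length w}"
proof -
  have "letter w ` {1..length w} = {1..length w}" using assms unfolding letter_image perm_words_def by simp
  moreover from this have "inj_on (letter w) {1..length w}" by (intro eq_card_imp_inj_on) auto
  ultimately show ?thesis by (simp add: bij_betw_def)
qed

lemma word_perm_permutes:
  assumes "w \<in> perm_words"
  shows "word_perm w permutes {1..length w}"
proof (rule bij_imp_permutes)
  show "bij_betw (word_perm w) {1..length w} {1..length w}"
    using bij_betw_letter[OF assms] by (rule bij_betw_cong[THEN iffD1, rotated]) (simp add: word_perm_def)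
qed (auto simp: word_perm_def)

lemma perm_word_in_perm_words:
  assumes "\<sigma> permutes {1..n}"
  shows "perm_word n \<sigma> \<in> perm_words"
proof -
  have "set [1..<n + 1] = {1..n}" by auto
  then show ?thesis
    using permutes_inj_on[OF assms] permutes_image[OF assms]
    by (simp add: perm_words_def perm_word_def distinct_map del: upt_Suc)
qed

lemma word_perm_perm_word:
  assumes "\<sigma> permutes {1..n}"
  shows "word_perm (perm_word n \<sigma>) = \<sigma>"
proof
  fix i show "word_perm (perm_word n \<sigma>) i = \<sigma> i"
    using permutes_not_in[OF assms, of i] letter_map_upt[of i n \<sigma>]
    by (auto simp: word_perm_def perm_word_def simp del: upt_Suc)
qed

lemma perm_word_word_perm: "perm_word (length w) (word_perm w) = w"
proof -
  have "perm_word (length w) (word_perm w) = map (letter w) [1..<length w + 1]"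
    unfolding perm_word_def by (rule map_cong) (auto simp: word_perm_def)
  then show ?thesis by (simp only: map_letter_upt)
qed

lemma bij_betw_word_perm:
  "bij_betw word_perm {w \<in> perm_words. length w = n} {\<sigma>. \<sigma> permutes {1..n}}"
  by (rule bij_betw_byWitness[where f' = "perm_word n"])
    (use word_perm_permutes in \<open>auto simp: perm_word_word_perm word_perm_perm_word perm_word_in_perm_words\<close>)

text \<open>Inverse to \<open>red N\<close> on ranks, for finite N. Ranks start at 1, list indices
  at 0.\<close>

definition unred :: "nat set \<Rightarrow> nat \<Rightarrow> nat" where
  "unred N j = sorted_list_of_set N ! (j - 1)"

lemma unred_red: "finite N \<Longrightarrow> i \<in> N \<Longrightarrow> unred N (red N i) = i"
  by (simp add: unred_def nth_red del: One_nat_def)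

lemma red_unred: "finite N \<Longrightarrow> j \<in> {1..card N} \<Longrightarrow> red N (unred N j) = j"
  using red_nth[of N "j - 1"] by (auto simp: unred_def)

lemma unred_in:
  assumes "finite N" "j \<in> {1..card N}"
  shows "unred N j \<in> N"
proof -
  have "j - 1 < length (sorted_list_of_set N)" using assms by auto
  then have "unred N j \<in> set (sorted_list_of_set N)" unfolding unred_def by (rule nth_mem)
  then show ?thesis using assms by simp
qed

lemma bij_betw_unred: "finite N \<Longrightarrow> bij_betw (unred N) {1..card N} N"
  by (rule bij_betw_byWitness[where f' = "red N"])
    (use red_in in \<open>auto simp: unred_red red_unred unred_in simp del: One_nat_def\<close>)

lemma unred_less_iff:
  "finite N \<Longrightarrow> i \<in> {1..card N} \<Longrightarrow> j \<in> {1..card N} \<Longrightarrow> unred N i < unred N j \<longleftrightarrow> i < j"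
  using red_less_iff[of N "unred N i" "unred N j"] by (simp add: red_unred unred_in del: One_nat_def)

subsection \<open>The fixed decomposition\<close>

definition der_words :: "nat list set" where
  "der_words = {d \<in> perm_words. \<forall>i\<in>{1..length d}. letter d i \<noteq> i}"

lemma NFIX_eq: "NFIX n \<sigma> = {1..n} - FIX n \<sigma>"
  by (auto simp: NFIX_def FIX_def)

lemma NFIX_image:
  assumes "\<sigma> permutes {1..n}"
  shows "\<sigma> ` NFIX n \<sigma> = NFIX n \<sigma>"
proof (rule card_subset_eq)
  show "\<sigma> ` NFIX n \<sigma> \<subseteq> NFIX n \<sigma>"
  proof (rule image_subsetI)
    fix i assume "i \<in> NFIX n \<sigma>"
    then have "i \<in> {1..n}" "\<sigma> i \<noteq> i" by (simp_all add: NFIX_def)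
    then have "\<sigma> i \<in> {1..n}" "\<sigma> (\<sigma> i) \<noteq> \<sigma> i"
      by (simp_all only: permutes_in_image[OF assms] inj_eq[OF permutes_inj[OF assms]] not_False_eq_True)
    then show "\<sigma> i \<in> NFIX n \<sigma>" by (simp add: NFIX_def)
  qed
  show "card (\<sigma> ` NFIX n \<sigma>) = card (NFIX n \<sigma>)"
    using permutes_inj_on[OF assms] by (rule card_image)
qed (simp add: NFIX_def)

lemma length_Der: "length (Der n \<sigma>) = card (NFIX n \<sigma>)"
  by (simp add: Der_def NFIX_def)

lemma letter_Der:
  assumes "i \<in> NFIX n \<sigma>"
  shows "letter (Der n \<sigma>) (red (NFIX n \<sigma>) i) = red (NFIX n \<sigma>) (\<sigma> i)"
proof -
  have fin: "finite (NFIX n \<sigma>)" by (simp add: NFIX_def)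
  then have "red (NFIX n \<sigma>) i - 1 < card (NFIX n \<sigma>)" using red_in[OF fin assms] by auto
  with fin assms show ?thesis by (simp add: letter_def Der_def nth_red del: One_nat_def)
qed

lemma Der_in_der_words:
  assumes "\<sigma> permutes {1..n}"
  shows "Der n \<sigma> \<in> der_words"
proof -
  let ?N = "NFIX n \<sigma>"
  have fin: "finite ?N" by (simp add: NFIX_def)
  have img: "\<sigma> i \<in> ?N" if "i \<in> ?N" for i using NFIX_image[OF assms] that by auto
  have "set (Der n \<sigma>) = red ?N ` \<sigma> ` ?N" using fin by (simp add: Der_def image_image)
  also have "\<dots> = {1..card ?N}"
    unfolding NFIX_image[OF assms] using red_bij_betw[OF fin] by (simp add: bij_betw_def)
  finally have set: "set (Der n \<sigma>) = {1..length (Der n \<sigma>)}" unfolding length_Der .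
  then have "distinct (Der n \<sigma>)" by (intro card_distinct) simp
  moreover have "letter (Der n \<sigma>) j \<noteq> j" if j: "j \<in> {1..length (Der n \<sigma>)}" for j
  proof -
    have i: "unred ?N j \<in> ?N" "red ?N (unred ?N j) = j"
      using j unred_in[OF fin] red_unred[OF fin] unfolding length_Der by blast+
    have "red ?N (\<sigma> (unred ?N j)) \<noteq> red ?N (unred ?N j)"
      using red_eq_iff[OF fin img[OF i(1)] i(1)] i(1) by (simp add: NFIX_def)
    with letter_Der[OF i(1)] i(2) show ?thesis by simp
  qed
  ultimately show ?thesis using set unfolding der_words_def perm_words_def by blast
qed

lemma FIX_in_positions: "FIX n \<sigma> \<in> positions n (length (Der n \<sigma>))"
proof -
  have sub: "FIX n \<sigma> \<subseteq> {1..n}" by (auto simp: FIX_def)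
  then have "card (FIX n \<sigma>) + card ({1..n} - FIX n \<sigma>) = n"
    using card_mono[OF _ sub] by (simp add: card_Diff_subset finite_subset)
  with sub show ?thesis by (simp add: positions_def length_Der NFIX_eq)
qed

text \<open>Inverse to taking \<open>Der\<close> and \<open>FIX\<close>: d acts on
  \<open>{1..n} - S\<close> through the ranks. The default value i yields the fixed points in S and
  also the identity outside \<open>{1..n}\<close> that \<open>permutes\<close> demands.\<close>

definition unfix :: "nat \<Rightarrow> nat list \<Rightarrow> nat set \<Rightarrow> nat \<Rightarrow> nat" where
  "unfix n d S i = (if i \<in> {1..n} - S then unred ({1..n} - S) (letter d (red ({1..n} - S) i)) else i)"

lemma unfix_Der_FIX:
  assumes "\<sigma> permutes {1..n}"
  shows "unfix n (Der n \<sigma>) (FIX n \<sigma>) = \<sigma>"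
proof
  fix i
  show "unfix n (Der n \<sigma>) (FIX n \<sigma>) i = \<sigma> i"
  proof (cases "i \<in> NFIX n \<sigma>")
    case True
    then have "\<sigma> i \<in> NFIX n \<sigma>" using NFIX_image[OF assms] by auto
    then have "unred (NFIX n \<sigma>) (red (NFIX n \<sigma>) (\<sigma> i)) = \<sigma> i" by (intro unred_red) (auto simp: NFIX_def)
    with True show ?thesis
      unfolding unfix_def NFIX_eq[symmetric] letter_Der[OF True] by simp
  next
    case False
    moreover from this have "\<sigma> i = i"
      using permutes_not_in[OF assms] unfolding NFIX_def by blast
    ultimately show ?thesis unfolding unfix_def NFIX_eq[symmetric] by simp
  qed
qed

lemma unfix_props:
  assumes d: "d \<in> der_words" and S: "S \<in> positions n (length d)"
  shows "unfix n d S permutes {1..n}" "FIX n (unfix n d S) = S" "Der n (unfix n d S) = d"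
proof -
  let ?N = "{1..n} - S" and ?\<tau> = "unfix n d S"
  have fin: "finite ?N" by simp
  have card: "card ?N = length d" using S by (rule card_compl_positions)
  have dp: "d \<in> perm_words" using d by (simp add: der_words_def)
  \<comment> \<open>Off S the map is d conjugated by the rank bijection.\<close>
  have "bij_betw (unred ?N \<circ> (letter d \<circ> red ?N)) ?N ?N"
    using red_bij_betw[OF fin] bij_betw_letter[OF dp] bij_betw_unred[OF fin]
    unfolding card by (intro bij_betw_trans)
  then have "bij_betw ?\<tau> ?N ?N"
    by (rule bij_betw_cong[THEN iffD1, rotated]) (simp add: unfix_def)
  then have "?\<tau> permutes ?N" by (rule bij_imp_permutes) (unfold unfix_def, rule if_not_P)
  then show perm: "?\<tau> permutes {1..n}" by (rule permutes_subset) auto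
  have red: "red ?N (?\<tau> i) = letter d (red ?N i)" "red ?N i \<in> {1..length d}" if "i \<in> ?N" for i
  proof -
    show r: "red ?N i \<in> {1..length d}" using red_in[OF fin that] card by simp
    then have "letter d (red ?N i) \<in> {1..length d}"
      using bij_betw_letter[OF dp] bij_betwE by blast
    then show "red ?N (?\<tau> i) = letter d (red ?N i)"
      using that red_unred[OF fin] card by (simp add: unfix_def)
  qed
  have "?\<tau> i \<noteq> i" if "i \<in> ?N" for i
  proof -
    have "letter d (red ?N i) \<noteq> red ?N i" using d red(2)[OF that] by (simp add: der_words_def)
    then show ?thesis using red(1)[OF that] by auto
  qed
  moreover have "?\<tau> i = i" if "i \<in> S" for i using that by (simp add: unfix_def)
  moreover have "S \<subseteq> {1..n}" using S by (simp add: positions_def)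
  ultimately show FIX: "FIX n ?\<tau> = S" unfolding FIX_def by blast
  have "Der n ?\<tau> = map (\<lambda>j. letter d (red ?N j)) (sorted_list_of_set ?N)"
    unfolding Der_def NFIX_eq FIX using red(1) by (intro map_cong) auto
  also have "\<dots> = d"
    using map_letter_upt[of d] card by (simp add: map_red_sorted_list)
  finally show "Der n ?\<tau> = d" .
qed

lemma bij_betw_Der_FIX:
  "bij_betw (\<lambda>\<sigma>. (Der n \<sigma>, FIX n \<sigma>)) {\<sigma>. \<sigma> permutes {1..n}}
     (SIGMA d:{d \<in> der_words. length d \<le> n}. positions n (length d))"
proof (rule bij_betw_byWitness[where f' = "\<lambda>(d, S). unfix n d S"])
  show "(\<lambda>\<sigma>. (Der n \<sigma>, FIX n \<sigma>)) ` {\<sigma>. \<sigma> permutes {1..n}} \<subseteq>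
    (SIGMA d:{d \<in> der_words. length d \<le> n}. positions n (length d))"
  proof
    fix p assume "p \<in> (\<lambda>\<sigma>. (Der n \<sigma>, FIX n \<sigma>)) ` {\<sigma>. \<sigma> permutes {1..n}}"
    then obtain \<sigma> where "\<sigma> permutes {1..n}" "p = (Der n \<sigma>, FIX n \<sigma>)" by auto
    moreover have "length (Der n \<sigma>) \<le> n" using FIX_in_positions[of n \<sigma>] by (simp add: positions_def)
    ultimately show "p \<in> (SIGMA d:{d \<in> der_words. length d \<le> n}. positions n (length d))"
      using FIX_in_positions Der_in_der_words by simp
  qed
  show "\<forall>\<sigma>\<in>{\<sigma>. \<sigma> permutes {1..n}}. (\<lambda>(d, S). unfix n d S) (Der n \<sigma>, FIX n \<sigma>) = \<sigma>"
    by (simp add: unfix_Der_FIX del: One_nat_def)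
qed (use unfix_props in \<open>fastforce+\<close>)

text \<open>\<open>ZDer\<close> is the shuffle of \<open>Der\<close> with zeros at the fixed points,
  and zero lies below all letters of \<open>Der\<close>.\<close>

lemma DEZ_eq:
  assumes "\<sigma> permutes {1..n}"
  shows "DEZ n \<sigma> = merged_DES n (FIX n \<sigma>) (DES_word (Der n \<sigma>))"
proof -
  have "ZDer n \<sigma> = ins 0 n (FIX n \<sigma>) (Der n \<sigma>)"
    unfolding ZDer_def ins_def NFIX_eq[symmetric]
  proof (rule map_cong[OF refl])
    fix i assume "i \<in> set [1..<n + 1]"
    then have "i \<in> FIX n \<sigma> \<longleftrightarrow> \<sigma> i = i" "\<sigma> i \<noteq> i \<Longrightarrow> i \<in> NFIX n \<sigma>"
      by (auto simp: FIX_def NFIX_def)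
    then show "(if \<sigma> i = i then 0 else red (NFIX n \<sigma>) (\<sigma> i)) =
      (if i \<in> FIX n \<sigma> then 0 else letter (Der n \<sigma>) (red (NFIX n \<sigma>) i))"
      by (simp add: letter_Der)
  qed
  then show ?thesis
    using DES_ins_zero[OF FIX_in_positions] Der_in_der_words[OF assms] zero_notin_perm_word
    by (auto simp: DEZ_def der_words_def)
qed

lemma maf_eq: "maf n \<sigma> = excess (FIX n \<sigma>) + maj_word (Der n \<sigma>)"
  by (simp add: maf_def excess_def fix_num_def)

lemma maz_eq: "maz n \<sigma> = \<Sum>(DEZ n \<sigma>)"
  by (simp add: maz_def maj_word_def DEZ_def)

lemma maj_eq: "maj n \<sigma> = \<Sum>(DES n \<sigma>)"
  by (simp add: maj_def maj_word_def DES_def)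

text \<open>A fixed point \<open>i\<close> next to an excedance (\<open>\<sigma> j > j\<close>) is below it, and next to a
  letter \<open>\<sigma> j < j\<close> it is above it. Hence the descents do not change if all fixed points become
  the same letter \<open>length d + 1\<close> and all excedances are raised above it.\<close>

definition raise :: "nat list \<Rightarrow> nat list" where
  "raise d = map (\<lambda>j. if letter d j < j then letter d j else letter d j + length d + 1) [1..<length d + 1]"

lemma raise_props:
  assumes "d \<in> der_words"
  shows "DES_word (raise d) = DES_word d" "length (raise d) = length d" "Suc (length d) \<notin> set (raise d)"
proof -
  have in_d: "letter d j \<in> {1..length d}" if "j \<in> {1..length d}" for j
    using assms that bij_betw_letter bij_betwE unfolding der_words_def by blast
  have ne: "letter d j \<noteq> j" if "j \<in> {1..length d}" for j using assms that by (simp add: der_words_def)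
  show "length (raise d) = length d" by (simp add: raise_def del: upt_Suc)
  show "Suc (length d) \<notin> set (raise d)"
  proof
    assume "Suc (length d) \<in> set (raise d)"
    then obtain j where "j \<in> {1..length d}"
      "Suc (length d) = (if letter d j < j then letter d j else letter d j + length d + 1)"
      by (auto simp: raise_def simp del: upt_Suc)
    with in_d[of j] ne[of j] show False by (auto split: if_splits)
  qed
  let ?y = "\<lambda>j. if letter d j < j then letter d j else letter d j + length d + 1"
  \<comment> \<open>If one of two neighbouring letters exceeds its position and the other is below
    its position, the former is already the larger one, so raising it changes no comparison.\<close>
  have *: "?y j > ?y (Suc j) \<longleftrightarrow> letter d j > letter d (j + 1)" if "j \<in> {1..<length d}" for j
    using that ne[of j] ne[of "Suc j"] in_d[of j] in_d[of "Suc j"] by (auto simp del: letter_nth)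
  show "DES_word (raise d) = DES_word d"
    unfolding raise_def DES_map_upt unfolding DES_word_def
    by (rule Collect_cong, rule conj_cong[OF refl], rule *)
qed

lemma DES_eq:
  assumes "\<sigma> permutes {1..n}"
  shows "DES n \<sigma> = DES_word (ins (Suc (length (Der n \<sigma>))) n (FIX n \<sigma>) (raise (Der n \<sigma>)))"
proof -
  let ?N = "NFIX n \<sigma>" and ?m = "length (Der n \<sigma>)"
  let ?y = "\<lambda>i. if i \<in> FIX n \<sigma> then Suc ?m else letter (raise (Der n \<sigma>)) (red ({1..n} - FIX n \<sigma>) i)"
  have fin: "finite ?N" by (simp add: NFIX_def)
  have img: "\<sigma> i \<in> ?N" if "i \<in> ?N" for i using NFIX_image[OF assms] that by auto
  have r: "red ?N i \<in> {1..?m}" if "i \<in> ?N" for i using red_in[OF fin that] by (simp add: length_Der)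
  \<comment> \<open>Ranks preserve order, so \<open>\<sigma> i < i\<close> can be tested in
    \<open>Der\<close>, and the raised letters can be described by \<sigma> itself.\<close>
  have y: "?y i = (if \<sigma> i = i then Suc ?m else if \<sigma> i < i then red ?N (\<sigma> i) else red ?N (\<sigma> i) + ?m + 1)"
    if "i \<in> {1..n}" for i
  proof (cases "\<sigma> i = i")
    case False
    then have i: "i \<in> ?N" using that by (simp add: NFIX_def)
    have "letter (raise (Der n \<sigma>)) (red ?N i) =
      (if red ?N (\<sigma> i) < red ?N i then red ?N (\<sigma> i) else red ?N (\<sigma> i) + ?m + 1)"
      unfolding raise_def letter_map_upt[OF r[OF i]] letter_Der[OF i] ..
    moreover have "i \<notin> FIX n \<sigma>" using False by (simp add: FIX_def)
    ultimately show ?thesis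
      using False red_less_iff[OF fin img[OF i] i] unfolding NFIX_eq[symmetric] by simp
  qed (use that in \<open>simp add: FIX_def\<close>)
  \<comment> \<open>The letter \<open>Suc ?m\<close> of the fixed points separates the unraised from
    the raised letters. Neighbouring fixed points do not descend, and neither do the equal letters
    that replace them.\<close>
  have *: "\<sigma> i > \<sigma> (Suc i) \<longleftrightarrow> ?y i > ?y (Suc i)" if i: "i \<in> {1..<n}" for i
  proof -
    have in_n: "i \<in> {1..n}" "Suc i \<in> {1..n}" using i by auto
    have ne: "\<sigma> i \<noteq> \<sigma> (Suc i)" using permutes_inj[OF assms] by (simp add: inj_eq)
    have N: "\<sigma> j \<noteq> j \<Longrightarrow> j \<in> ?N" if "j \<in> {1..n}" for j using that by (simp add: NFIX_def)
    show ?thesis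
      unfolding y[OF in_n(1)] y[OF in_n(2)]
      using N[OF in_n(1)] N[OF in_n(2)] r[OF img, of i] r[OF img, of "Suc i"]
        red_less_iff[OF fin img img, of "Suc i" i] ne
      by (cases "\<sigma> i = i"; cases "\<sigma> (Suc i) = Suc i") auto
  qed
  show ?thesis unfolding DES_def perm_word_def ins_def DES_map_upt
    by (rule Collect_cong, rule conj_cong[OF refl], rule *)
qed

subsection \<open>Concatenation of an increasing word and a reduced word\<close>

text \<open>For desarrangements v this inverts the pixed decomposition; for a singleton T it
  prepends a first letter, as the induction for MacMahon's theorem requires.\<close>

definition cat :: "nat \<Rightarrow> nat set \<Rightarrow> nat list \<Rightarrow> nat list" where
  "cat n T v = sorted_list_of_set T @ map (unred ({1..n} - T)) v"

lemma set_map_unred: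
  assumes "v \<in> perm_words" "finite N" "card N = length v"
  shows "set (map (unred N) v) = N"
  using bij_betw_unred[OF assms(2)] assms by (simp add: perm_words_def bij_betw_def)

lemma finite_positions_elem: "T \<in> positions n m \<Longrightarrow> finite T"
  by (auto simp: positions_def intro: finite_subset)

lemma cat_in_perm_words:
  assumes v: "v \<in> perm_words" and T: "T \<in> positions n (length v)"
  shows "cat n T v \<in> perm_words" "length (cat n T v) = n"
proof -
  let ?N = "{1..n} - T"
  have fin: "finite T" using T by (rule finite_positions_elem)
  show len: "length (cat n T v) = n" using T fin by (simp add: cat_def positions_def)
  have "set (cat n T v) = T \<union> ?N"
    using set_map_unred[OF v _ card_compl_positions[OF T]] fin by (simp add: cat_def)
  then have set: "set (cat n T v) = {1..n}" using T by (auto simp: positions_def)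
  then have "distinct (cat n T v)" using len by (intro card_distinct) simp
  with set len show "cat n T v \<in> perm_words" by (simp add: perm_words_def)
qed

lemma cat_cancel:
  assumes v: "v \<in> perm_words" and T: "T \<in> positions n (length v)"
  shows "set (take (card T) (cat n T v)) = T"
    "map (red ({1..n} - T)) (drop (card T) (cat n T v)) = v"
proof -
  have fin: "finite T" using T by (rule finite_positions_elem)
  then show "set (take (card T) (cat n T v)) = T" by (simp add: cat_def)
  have "red ({1..n} - T) (unred ({1..n} - T) j) = j" if "j \<in> set v" for j
    using that v card_compl_positions[OF T] by (intro red_unred) (auto simp: perm_words_def)
  then show "map (red ({1..n} - T)) (drop (card T) (cat n T v)) = v"
    using fin by (simp add: cat_def map_idI)
qed

text \<open>Every cut behind an increasing prefix gives a factorization. The cut c is left open,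
  since it will be the pixed cut in one place and 1 in another.\<close>

lemma cat_take_drop:
  assumes w: "w \<in> perm_words" "length w = n" and c: "c \<le> n" "sorted (take c w)"
  defines "T \<equiv> set (take c w)"
  defines "v \<equiv> map (red ({1..n} - T)) (drop c w)"
  shows "v \<in> perm_words" "T \<in> positions n (length v)" "cat n T v = w" "card T = c"
    "set (drop c w) = {1..n} - T"
proof -
  let ?N = "{1..n} - T"
  have dist: "distinct w" and set: "set w = {1..n}" using w by (auto simp: perm_words_def)
  have "set (take c w) \<union> set (drop c w) = {1..n}"
    using set by (metis append_take_drop_id set_append)
  moreover have "set (take c w) \<inter> set (drop c w) = {}"
    using dist by (metis append_take_drop_id distinct_append)
  ultimately show drop: "set (drop c w) = ?N" by (auto simp: T_def)
  show card: "card T = c"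
    using dist w c by (simp add: T_def distinct_card)
  have len: "length v = n - c" using w by (simp add: v_def)
  have sub: "T \<subseteq> {1..n}" using set by (auto simp: T_def dest: in_set_takeD)
  show positions: "T \<in> positions n (length v)" using sub card c len by (simp add: positions_def)
  have cardN: "card ?N = length v" using positions by (rule card_compl_positions)
  have "set v = {1..length v}"
    using red_bij_betw[of ?N] cardN unfolding v_def set_map drop by (simp add: bij_betw_def)
  moreover from this have "distinct v" by (intro card_distinct) simp
  ultimately show "v \<in> perm_words" by (simp add: perm_words_def)
  have "sorted_list_of_set T = take c w"
    using c(2) dist unfolding T_def by (simp add: sorted_list_of_set.idem_if_sorted_distinct)
  moreover have "map (unred ?N) v = drop c w"
    unfolding v_def map_map comp_def using drop by (intro map_idI unred_red) auto
  ultimately show "cat n T v = w" by (simp add: cat_def)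
qed

lemma letter_cat:
  assumes v: "v \<in> perm_words" and T: "T \<in> positions n (length v)"
  shows "c \<in> T \<Longrightarrow> letter (cat n T v) (red T c) = c"
    "j \<in> {1..length v} \<Longrightarrow> letter (cat n T v) (card T + j) = unred ({1..n} - T) (letter v j)"
proof -
  have fin: "finite T" using T by (rule finite_positions_elem)
  show "letter (cat n T v) (red T c) = c" if "c \<in> T"
  proof -
    have "red T c \<in> {1..card T}" by (rule red_in[OF fin that])
    then have "letter (cat n T v) (red T c) = sorted_list_of_set T ! (red T c - 1)"
      using fin by (auto simp: letter_def cat_def nth_append)
    then show ?thesis using nth_red[OF fin that] by simp
  qed
  show "letter (cat n T v) (card T + j) = unred ({1..n} - T) (letter v j)" if "j \<in> {1..length v}"
  proof -
    obtain i where "j = Suc i" "i < length v" using \<open>j \<in> {1..length v}\<close> by (cases j) auto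
    with fin show ?thesis by (simp add: cat_def nth_append)
  qed
qed

lemma IDES_eq: "IDES n \<sigma> = {i \<in> {1..<n}. inv \<sigma> i > inv \<sigma> (Suc i)}"
  unfolding IDES_def DES_def perm_word_def by (rule DES_map_upt)

text \<open>The inverse maps letters to positions. The letters of T occupy the first positions in
  increasing order, and the remaining letters follow in the order prescribed by v; this is the
  situation of \<open>merged_DES_eq\<close>.\<close>

lemma IDES_cat:
  assumes v: "v \<in> perm_words" and T: "T \<in> positions n (length v)"
  shows "IDES n (word_perm (cat n T v)) = merged_DES n T (IDES (length v) (word_perm v))"
proof -
  let ?N = "{1..n} - T" and ?m = "length v"
  let ?\<sigma> = "word_perm (cat n T v)" and ?\<pi> = "word_perm v"
  have fin: "finite T" "finite ?N" using T by (auto intro: finite_positions_elem)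
  have cardN: "card ?N = ?m" using T by (rule card_compl_positions)
  have \<sigma>: "?\<sigma> permutes {1..n}" using word_perm_permutes[OF cat_in_perm_words(1)[OF v T]] unfolding cat_in_perm_words(2)[OF v T] .
  have \<pi>: "?\<pi> permutes {1..?m}" using v by (rule word_perm_permutes)
  have n: "card T + ?m = n" using T by (simp add: positions_def)
  have inv_T: "inv ?\<sigma> c = red T c" and red_T: "red T c \<in> {1..card T}" if "c \<in> T" for c
  proof -
    show r: "red T c \<in> {1..card T}" by (rule red_in[OF fin(1) that])
    then have "?\<sigma> (red T c) = c"
      using n letter_cat(1)[OF v T that] cat_in_perm_words(2)[OF v T] by (simp add: word_perm_def)
    then show "inv ?\<sigma> c = red T c" by (rule inv_f_eq[OF permutes_inj[OF \<sigma>]])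
  qed
  have inv_N: "inv ?\<sigma> c = card T + inv ?\<pi> (red ?N c)" and pos: "inv ?\<pi> (red ?N c) \<ge> 1" if "c \<in> ?N" for c
  proof -
    let ?p = "inv ?\<pi> (red ?N c)"
    have "red ?N c \<in> {1..?m}" using red_in[OF fin(2) that] cardN by simp
    then have p: "?p \<in> {1..?m}" by (simp only: permutes_in_image[OF permutes_inv[OF \<pi>]])
    then show "?p \<ge> 1" by simp
    have "letter v ?p = ?\<pi> ?p" using p by (simp only: word_perm_def if_True)
    also have "\<dots> = red ?N c" by (rule permutes_inverses(1)[OF \<pi>])
    finally have "letter v ?p = red ?N c" .
    then have "letter (cat n T v) (card T + ?p) = c"
      using letter_cat(2)[OF v T p] unred_red[OF fin(2) that] by simp
    moreover have "card T + ?p \<in> {1..n}" using p n by auto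
    ultimately have "?\<sigma> (card T + ?p) = c"
      unfolding word_perm_def cat_in_perm_words(2)[OF v T] by (simp only: if_True)
    then show "inv ?\<sigma> c = card T + ?p" by (rule inv_f_eq[OF permutes_inj[OF \<sigma>]])
  qed
  show ?thesis
    unfolding IDES_eq
  proof (rule merged_DES_eq[OF T])
    show "inv ?\<sigma> i \<le> inv ?\<sigma> (Suc i)" if "Suc i \<in> T" "i \<in> T" for i
      using red_less_iff[OF fin(1) that(2,1)] inv_T[OF that(1)] inv_T[OF that(2)] by simp
    show "inv ?\<sigma> i < inv ?\<sigma> j" if "i \<in> T" "j \<in> ?N" for i j
      using inv_T[OF that(1)] red_T[OF that(1)] inv_N[OF that(2)] pos[OF that(2)] by simp
    show "inv ?\<sigma> i < inv ?\<sigma> j \<longleftrightarrow> inv ?\<pi> (red ?N i) < inv ?\<pi> (red ?N j)" if "i \<in> ?N" "j \<in> ?N" for i j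
      using inv_N[OF that(1)] inv_N[OF that(2)] by simp
  qed
qed

text \<open>Of the numbers from 1 to an element x of T, exactly \<open>red T x\<close> lie in T, so
  \<open>x - red T x\<close> smaller ones lie outside. These differences add up to the
  excess.\<close>

lemma card_inversions_across:
  assumes T: "T \<in> positions n m"
  shows "card {(x, y). x \<in> T \<and> y \<in> {1..n} - T \<and> y < x} = excess T"
proof -
  have fin: "finite T" using T by (rule finite_positions_elem)
  have sub: "T \<subseteq> {1..n}" using T by (simp add: positions_def)
  let ?L = "\<lambda>x. {y \<in> {1..n} - T. y < x}"
  have "card (?L x) + red T x = x" if "x \<in> T" for x
  proof -
    have "{1..x} = ?L x \<union> {a \<in> T. a \<le> x}"
    proof (rule set_eqI)
      fix a show "a \<in> {1..x} \<longleftrightarrow> a \<in> ?L x \<union> {a \<in> T. a \<le> x}"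
        using subsetD[OF sub, of a] subsetD[OF sub that] that by (cases "a = x"; cases "a \<in> T") auto
    qed
    moreover have "card (?L x \<union> {a \<in> T. a \<le> x}) = card (?L x) + card {a \<in> T. a \<le> x}"
      using fin by (intro card_Un_disjoint) auto
    ultimately have "card {1..x} = card (?L x) + red T x" by (simp only: red_def)
    then show ?thesis by simp
  qed
  then have "\<Sum>T = (\<Sum>x\<in>T. card (?L x)) + (\<Sum>x\<in>T. red T x)"
    by (simp add: sum.distrib[symmetric])
  moreover have "(\<Sum>x\<in>T. red T x) = (\<Sum>i=1..card T. i)"
    using sum.reindex_bij_betw[OF red_bij_betw[OF fin], of "\<lambda>i. i"] by simp
  moreover have "{(x, y). x \<in> T \<and> y \<in> {1..n} - T \<and> y < x} = (SIGMA x:T. ?L x)" by auto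
  ultimately show ?thesis using fin by (simp add: excess_def)
qed

text \<open>The prefix is increasing, so an inversion pairs a letter of T with a smaller letter of
  the rest, or it lies within the rest, which is ordered like v.\<close>

lemma inversions_cat:
  assumes v: "v \<in> perm_words" and T: "T \<in> positions n (length v)"
  shows "inversions n (word_perm (cat n T v)) = excess T + inversions (length v) (word_perm v)"
proof -
  let ?N = "{1..n} - T" and ?m = "length v" and ?k = "card T"
  let ?\<sigma> = "word_perm (cat n T v)" and ?\<pi> = "word_perm v"
  have fin: "finite T" "finite ?N" using T by (auto intro: finite_positions_elem)
  have cardN: "card ?N = ?m" using T by (rule card_compl_positions)
  have n: "?k + ?m = n" using T by (simp add: positions_def)
  have \<pi>: "?\<pi> permutes {1..?m}" using v by (rule word_perm_permutes)
  have low: "?\<sigma> i = unred T i" if "i \<in> {1..?k}" for i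
  proof -
    have "?\<sigma> i = letter (cat n T v) i"
      using that n by (simp add: word_perm_def cat_in_perm_words(2)[OF v T])
    also have "\<dots> = letter (cat n T v) (red T (unred T i))" using red_unred[OF fin(1) that] by simp
    also have "\<dots> = unred T i" by (rule letter_cat(1)[OF v T unred_in[OF fin(1) that]])
    finally show ?thesis .
  qed
  have high: "?\<sigma> (?k + j) = unred ?N (?\<pi> j)" and \<pi>j: "?\<pi> j \<in> {1..?m}" if "j \<in> {1..?m}" for j
  proof -
    have "?k + j \<in> {1..n}" using that n by auto
    then have "?\<sigma> (?k + j) = letter (cat n T v) (?k + j)"
      unfolding word_perm_def cat_in_perm_words(2)[OF v T] by (simp only: if_True)
    also have "\<dots> = unred ?N (letter v j)" by (rule letter_cat(2)[OF v T that])
    also have "letter v j = ?\<pi> j" using that by (simp only: word_perm_def if_True)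
    finally show "?\<sigma> (?k + j) = unred ?N (?\<pi> j)" .
    show "?\<pi> j \<in> {1..?m}" using that by (simp only: permutes_in_image[OF \<pi>])
  qed
  let ?I = "{(i, j). i \<in> {1..n} \<and> j \<in> {1..n} \<and> i < j \<and> ?\<sigma> i > ?\<sigma> j}"
  let ?A = "{(x, y). x \<in> T \<and> y \<in> ?N \<and> y < x}"
  let ?B = "{(i, j). i \<in> {1..?m} \<and> j \<in> {1..?m} \<and> i < j \<and> ?\<pi> i > ?\<pi> j}"
  \<comment> \<open>\<open>?f\<close> turns a pair of letters into the pair of their positions, and
    \<open>?g\<close> moves positions of v behind the prefix.\<close>
  let ?f = "\<lambda>(x, y). (red T x, ?k + inv ?\<pi> (red ?N y))" and ?g = "\<lambda>(i, j). (?k + i, ?k + j)"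
  have invN: "inv ?\<pi> (red ?N y) \<in> {1..?m}" "?\<sigma> (?k + inv ?\<pi> (red ?N y)) = y" if "y \<in> ?N" for y
  proof -
    have "red ?N y \<in> {1..?m}" using red_in[OF fin(2) that] cardN by simp
    then show p: "inv ?\<pi> (red ?N y) \<in> {1..?m}" by (simp only: permutes_in_image[OF permutes_inv[OF \<pi>]])
    show "?\<sigma> (?k + inv ?\<pi> (red ?N y)) = y"
      unfolding high[OF p] permutes_inverses(1)[OF \<pi>] using that by (intro unred_red fin)
  qed
  have invT: "red T x \<in> {1..?k}" "?\<sigma> (red T x) = x" if "x \<in> T" for x
    using red_in[OF fin(1) that] low[of "red T x"] unred_red[OF fin(1) that] by auto
  have "?I = ?f ` ?A \<union> ?g ` ?B"
  proof (intro equalityI subsetI)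
    fix p assume "p \<in> ?I"
    then obtain i j where p: "p = (i, j)" "i \<in> {1..n}" "j \<in> {1..n}" "i < j" "?\<sigma> i > ?\<sigma> j" by auto
    show "p \<in> ?f ` ?A \<union> ?g ` ?B"
    proof (cases "i \<le> ?k")
      case True
      then have i: "i \<in> {1..?k}" using p by auto
      show ?thesis
      proof (cases "j \<le> ?k")
        case True
        then have j: "j \<in> {1..?k}" using p by auto
        have "unred T i < unred T j" using unred_less_iff[OF fin(1) i j] p by simp
        with low[OF i] low[OF j] p show ?thesis by simp
      next
        case False
        define j' where "j' = j - ?k"
        have j': "j = ?k + j'" "j' \<in> {1..?m}" using False p n by (auto simp: j'_def)
        have "?\<pi> j' \<in> {1..card ?N}" using \<pi>j[OF j'(2)] cardN by simp
        then have y: "?\<sigma> j \<in> ?N" "red ?N (?\<sigma> j) = ?\<pi> j'"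
          unfolding j'(1) high[OF j'(2)] using unred_in[OF fin(2)] red_unred[OF fin(2)] by blast+
        have mem: "(?\<sigma> i, ?\<sigma> j) \<in> ?A" using y(1) low[OF i] unred_in[OF fin(1) i] p by simp
        have "p = (i, ?k + j')" using p(1) j'(1) by simp
        also have "\<dots> = ?f (?\<sigma> i, ?\<sigma> j)"
          unfolding prod.case y(2) permutes_inverses(2)[OF \<pi>] low[OF i] red_unred[OF fin(1) i] ..
        finally show ?thesis by (rule UnI1[OF rev_image_eqI[OF mem]])
      qed
    next
      case False
      define i' j' where "i' = i - ?k" and "j' = j - ?k"
      have ij: "i = ?k + i'" "i' \<in> {1..?m}" "j = ?k + j'" "j' \<in> {1..?m}" "i' < j'"
        using False p n by (auto simp: j'_def i'_def)
      have "?\<pi> i' \<in> {1..card ?N}" "?\<pi> j' \<in> {1..card ?N}" using \<pi>j ij cardN by auto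
      then have "?\<pi> i' > ?\<pi> j'"
        using p(5) unfolding ij(1,3) high[OF ij(2)] high[OF ij(4)] by (simp only: unred_less_iff[OF fin(2)])
      then have "(i', j') \<in> ?B" using ij by simp
      then show ?thesis using p(1) ij by (auto intro!: image_eqI[of _ _ "(i', j')"])
    qed
  next
    fix p assume "p \<in> ?f ` ?A \<union> ?g ` ?B"
    then show "p \<in> ?I"
    proof
      assume "p \<in> ?f ` ?A"
      then obtain x y where xy: "p = ?f (x, y)" "x \<in> T" "y \<in> ?N" "y < x" by auto
      with invT[OF xy(2)] invN[OF xy(3)] n show ?thesis by auto
    next
      assume "p \<in> ?g ` ?B"
      then obtain i j where ij: "p = (?k + i, ?k + j)" "i \<in> {1..?m}" "j \<in> {1..?m}" "i < j" "?\<pi> i > ?\<pi> j" by auto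
      have "?\<pi> i \<in> {1..card ?N}" "?\<pi> j \<in> {1..card ?N}" using \<pi>j ij cardN by auto
      then have "?\<sigma> (?k + i) > ?\<sigma> (?k + j)"
        using ij(5) unfolding high[OF ij(2)] high[OF ij(3)] by (simp only: unred_less_iff[OF fin(2)])
      with ij n show ?thesis by auto
    qed
  qed
  moreover have "?f ` ?A \<inter> ?g ` ?B = {}"
  proof (rule equals0I)
    fix p assume p: "p \<in> ?f ` ?A \<inter> ?g ` ?B"
    then obtain x y where xy: "p = ?f (x, y)" "x \<in> T" by blast
    obtain i j where ij: "p = ?g (i, j)" "i \<in> {1..?m}" using p by blast
    have "red T x = ?k + i" using xy(1) ij(1) by simp
    with ij(2) invT(1)[OF xy(2)] show False by simp
  qed
  moreover have "finite ?A" by (rule finite_subset[of _ "T \<times> ?N"]) (use fin in auto)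
  moreover have "finite ?B" by (rule finite_subset[of _ "{1..?m} \<times> {1..?m}"]) auto
  ultimately have "card ?I = card (?f ` ?A) + card (?g ` ?B)"
    by (simp only: card_Un_disjoint finite_imageI)
  also have "card (?f ` ?A) = card ?A"
  proof (rule card_image, rule inj_onI)
    fix p q assume pq: "p \<in> ?A" "q \<in> ?A" "?f p = ?f q"
    obtain x y x' y' where xy: "p = (x, y)" "q = (x', y')" by (metis surj_pair)
    have mem: "x \<in> T" "x' \<in> T" "y \<in> ?N" "y' \<in> ?N" and eq: "red T x = red T x'"
      "?k + inv ?\<pi> (red ?N y) = ?k + inv ?\<pi> (red ?N y')"
      using pq unfolding xy by simp_all
    have "x = x'" using invT(2)[OF mem(1)] invT(2)[OF mem(2)] unfolding eq(1) by (rule trans[OF sym])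
    moreover have "y = y'" using invN(2)[OF mem(3)] invN(2)[OF mem(4)] unfolding eq(2) by (rule trans[OF sym])
    ultimately show "p = q" unfolding xy by simp
  qed
  also have "card (?g ` ?B) = card ?B" by (rule card_image) (auto intro!: inj_onI)
  also have "card ?A = excess T" by (rule card_inversions_across[OF T])
  finally show ?thesis by (simp only: inversions_def)
qed

subsection \<open>The pixed decomposition\<close>

text \<open>In a nonempty word with distinct letters this is the position of the leftmost trough,
  with infinity after the last letter. The value 0 makes the empty word even.\<close>

fun dec_run :: "nat list \<Rightarrow> nat" where
  "dec_run [] = 0"
| "dec_run [x] = 1"
| "dec_run (x # y # w) = (if x > y then Suc (dec_run (y # w)) else 1)"

lemma dec_run_props:
  "w \<noteq> [] \<Longrightarrow> 1 \<le> dec_run w \<and> dec_run w \<le> length w \<and> (\<forall>i. Suc i < dec_run w \<longrightarrow> w ! i > w ! Suc i) \<and>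
    (dec_run w = length w \<or> w ! (dec_run w - 1) \<le> w ! dec_run w)"
proof (induction w rule: dec_run.induct)
  case (3 x y w)
  show ?case
  proof (cases "x > y")
    case True
    have IH: "1 \<le> dec_run (y # w) \<and> dec_run (y # w) \<le> length (y # w) \<and>
      (\<forall>i. Suc i < dec_run (y # w) \<longrightarrow> (y # w) ! i > (y # w) ! Suc i) \<and>
      (dec_run (y # w) = length (y # w) \<or> (y # w) ! (dec_run (y # w) - 1) \<le> (y # w) ! dec_run (y # w))"
      by (rule 3(1)[OF True list.distinct(2)])
    have "(x # y # w) ! i > (x # y # w) ! Suc i" if "Suc i < Suc (dec_run (y # w))" for i
      using that True IH by (cases i) auto
    moreover obtain r where "dec_run (y # w) = Suc r" using IH by (cases "dec_run (y # w)") auto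
    ultimately show ?thesis using True IH by simp
  qed auto
qed auto

text \<open>The witness k of a desarrangement must be half the length of the initial decreasing run.
  As the empty word has run 0, both alternatives in \<open>pixed_cut\<close> merge into one parity
  condition.\<close>

lemma desarrangement_iff:
  assumes "distinct w"
  shows "w = [] \<or> desarrangement w \<longleftrightarrow> even (dec_run w)"
proof (cases "w = []")
  case False
  note props = dec_run_props[OF False]
  have dec: "letter w i > letter w (i + 1)" if "i \<in> {1..<dec_run w}" for i
    using that props by (cases i) auto
  have asc: "letter w (dec_run w) < letter w (dec_run w + 1)" if "dec_run w \<noteq> length w"
  proof -
    have "w ! (dec_run w - 1) \<noteq> w ! dec_run w"
      using assms that props by (subst nth_eq_iff_index_eq) auto
    then show ?thesis using that props by (simp add: letter_def)
  qed
  show ?thesis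
  proof
    assume "w = [] \<or> desarrangement w"
    then obtain k where k: "k \<ge> 1" "2 * k \<le> length w" "\<forall>i\<in>{1..<2 * k}. letter w i > letter w (i + 1)"
      "2 * k = length w \<or> letter w (2 * k) < letter w (2 * k + 1)"
      using False by (auto simp: desarrangement_def)
    have "\<not> 2 * k < dec_run w" using dec[of "2 * k"] k props by auto
    moreover have "\<not> dec_run w < 2 * k"
    proof
      assume "dec_run w < 2 * k"
      then have "dec_run w \<in> {1..<2 * k}" "dec_run w \<noteq> length w" using props k by auto
      with k(3) asc show False by (meson less_asym)
    qed
    ultimately have "dec_run w = 2 * k" by simp
    then show "even (dec_run w)" by simp
  next
    assume "even (dec_run w)"
    then obtain k where k: "dec_run w = 2 * k" by blast
    have "desarrangement w"
      unfolding desarrangement_def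
    proof (intro conjI exI[of _ k])
      show "\<forall>i\<in>{1..<2 * k}. letter w i > letter w (i + 1)" using dec k by simp
      show "2 * k = length w \<or> letter w (2 * k) < letter w (2 * k + 1)" using asc k by auto
    qed (use assms props k in auto)
    then show "w = [] \<or> desarrangement w" ..
  qed
qed simp

lemma dec_run_map:
  "(\<And>x y. x \<in> set w \<Longrightarrow> y \<in> set w \<Longrightarrow> h x < h y \<longleftrightarrow> x < y) \<Longrightarrow> dec_run (map h w) = dec_run w"
  by (induction w rule: dec_run.induct) auto

definition dec_cut :: "nat list \<Rightarrow> nat" where
  "dec_cut w = (LEAST l. even (dec_run (drop l w)))"

lemma pixed_cut_eq: "distinct w \<Longrightarrow> pixed_cut w = dec_cut w"
  unfolding pixed_cut_def dec_cut_def by (simp only: desarrangement_iff[OF distinct_drop])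

lemma even_dec_run_dec_cut: "even (dec_run (drop (dec_cut w) w))"
  unfolding dec_cut_def by (rule LeastI[of _ "length w"]) simp

lemma dec_cut_le: "dec_cut w \<le> length w"
  unfolding dec_cut_def by (rule Least_le) simp

lemma dec_cut_even: "even (dec_run w) \<Longrightarrow> dec_cut w = 0"
  unfolding dec_cut_def by (rule Least_eq_0) simp

lemma dec_cut_Cons:
  assumes "odd (dec_run (x # w))"
  shows "dec_cut (x # w) = Suc (dec_cut w)"
proof -
  have "(LEAST l. even (dec_run (drop l (x # w)))) = Suc (LEAST l. even (dec_run (drop (Suc l) (x # w))))"
    by (rule Least_Suc[of _ "Suc (length w)"]) (use assms in auto)
  then show ?thesis by (simp add: dec_cut_def)
qed

text \<open>Suppose the run from x is odd. If x exceeds the next letter, the run from that letter is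
  even, so the cut comes right after x. Otherwise x continues the increasing prefix to the
  left.\<close>

lemma sorted_take_dec_cut: "distinct w \<Longrightarrow> sorted (take (dec_cut w) w)"
proof (induction w)
  case (Cons x w)
  show ?case
  proof (cases "even (dec_run (x # w))")
    case False
    have IH: "sorted (take (dec_cut w) w)" using Cons by simp
    show ?thesis
    proof (cases w)
      case (Cons y u)
      show ?thesis
      proof (cases "x > y")
        case True
        then have "dec_cut w = 0" using False Cons by (intro dec_cut_even) simp
        then show ?thesis using dec_cut_Cons[OF False] by simp
      next
        case xy: False
        have "x \<le> z" if "z \<in> set (take (dec_cut w) w)" for z
          using that xy IH Cons by (cases "dec_cut w") auto
        then show ?thesis using dec_cut_Cons[OF False] IH by simp
      qed
    qed (simp add: dec_cut_Cons[OF False])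
  qed (simp add: dec_cut_even)
qed simp

text \<open>No earlier cut is possible: from a letter of u other than the last the run is 1, and
  from the last one it is 1 or one more than the even run of v.\<close>

lemma dec_cut_append:
  "sorted u \<Longrightarrow> distinct (u @ v) \<Longrightarrow> even (dec_run v) \<Longrightarrow> dec_cut (u @ v) = length u"
proof (induction u)
  case (Cons x u)
  have "odd (dec_run (x # u @ v))"
  proof (cases u)
    case Nil
    then show ?thesis using Cons.prems by (cases v) auto
  next
    case (Cons y u')
    then have "x < y" using Cons.prems by (auto simp: le_less)
    with Cons show ?thesis by simp
  qed
  then show ?case using dec_cut_Cons[of x "u @ v"] Cons by simp
qed (simp add: dec_cut_even)

definition desar_words :: "nat list set" where
  "desar_words = {v \<in> perm_words. v = [] \<or> desarrangement v}"

lemma desar_words_iff: "v \<in> desar_words \<longleftrightarrow> v \<in> perm_words \<and> even (dec_run v)"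
  unfolding desar_words_def by (auto simp: perm_words_def desarrangement_iff[symmetric])

lemma Desar_PIX_props:
  assumes "\<sigma> permutes {1..n}"
  shows "Desar n \<sigma> \<in> desar_words" "PIX n \<sigma> \<in> positions n (length (Desar n \<sigma>))"
    "word_perm (cat n (PIX n \<sigma>) (Desar n \<sigma>)) = \<sigma>"
proof -
  let ?w = "perm_word n \<sigma>"
  have w: "?w \<in> perm_words" "length ?w = n" using perm_word_in_perm_words[OF assms] by auto
  have dist: "distinct ?w" using w by (simp add: perm_words_def)
  define c where "c = dec_cut ?w"
  have cut: "pixed_cut ?w = c" unfolding c_def by (rule pixed_cut_eq[OF dist])
  have PIX: "PIX n \<sigma> = set (take c ?w)" by (simp add: PIX_def pixed_part_def cut)
  have c: "c \<le> n" "sorted (take c ?w)"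
    using dec_cut_le[of ?w] sorted_take_dec_cut[OF dist] by (auto simp: c_def)
  \<comment> \<open>The pixed part is increasing, so the general factorization applies. Only the
    parity of the decreasing run remains to be shown, and reduction preserves it.\<close>
  note parts = cat_take_drop[OF w c, folded PIX]
  have Desar: "Desar n \<sigma> = map (red ({1..n} - PIX n \<sigma>)) (drop c ?w)"
    using parts(5) by (simp add: Desar_def desar_part_def cut)
  note parts' = parts[folded Desar]
  have "dec_run (Desar n \<sigma>) = dec_run (drop c ?w)"
    unfolding Desar by (rule dec_run_map, rule red_less_iff) (simp_all only: parts(5) finite_Diff finite_atLeastAtMost)
  then have "even (dec_run (Desar n \<sigma>))" using even_dec_run_dec_cut[of ?w] by (simp add: c_def)
  with parts'(1) show "Desar n \<sigma> \<in> desar_words" by (simp add: desar_words_iff)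
  show "PIX n \<sigma> \<in> positions n (length (Desar n \<sigma>))" by (rule parts'(2))
  show "word_perm (cat n (PIX n \<sigma>) (Desar n \<sigma>)) = \<sigma>"
    unfolding parts'(3) by (rule word_perm_perm_word[OF assms])
qed

lemma Desar_PIX_cat:
  assumes v: "v \<in> desar_words" and T: "T \<in> positions n (length v)"
  defines "\<sigma> \<equiv> word_perm (cat n T v)"
  shows "\<sigma> permutes {1..n}" "PIX n \<sigma> = T" "Desar n \<sigma> = v"
proof -
  let ?w = "cat n T v"
  have vp: "v \<in> perm_words" and even: "even (dec_run v)" using v by (auto simp: desar_words_iff)
  have w: "?w \<in> perm_words" "length ?w = n" using cat_in_perm_words[OF vp T] by auto
  show "\<sigma> permutes {1..n}" using word_perm_permutes[OF w(1)] unfolding \<sigma>_def w(2) .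
  have pw: "perm_word n \<sigma> = ?w" using perm_word_word_perm[of ?w] unfolding \<sigma>_def w(2) .
  have dist: "distinct ?w" using w by (simp add: perm_words_def)
  have setv: "set (map (unred ({1..n} - T)) v) = {1..n} - T"
    by (rule set_map_unred[OF vp _ card_compl_positions[OF T]]) simp
  have "dec_run (map (unred ({1..n} - T)) v) = dec_run v"
    by (rule dec_run_map, rule unred_less_iff) (use vp card_compl_positions[OF T] in \<open>auto simp: perm_words_def\<close>)
  \<comment> \<open>The pixed cut of the concatenation falls exactly behind the increasing prefix,
    which makes the factorization unique.\<close>
  then have "dec_cut ?w = length (sorted_list_of_set T)"
    using dist even unfolding cat_def by (intro dec_cut_append) auto
  then have cut: "pixed_cut ?w = card T" using pixed_cut_eq[OF dist] by simp
  show PIX: "PIX n \<sigma> = T"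
    using cat_cancel(1)[OF vp T] by (simp add: PIX_def pixed_part_def pw cut)
  have part: "desar_part n \<sigma> = drop (card T) ?w" unfolding desar_part_def pw cut ..
  also have "\<dots> = map (unred ({1..n} - T)) v" using finite_positions_elem[OF T] by (simp add: cat_def)
  finally have "set (desar_part n \<sigma>) = {1..n} - T" using setv by (simp only:)
  then show "Desar n \<sigma> = v"
    using cat_cancel(2)[OF vp T] unfolding Desar_def by (simp only: part)
qed

lemma bij_betw_Desar_PIX:
  "bij_betw (\<lambda>\<sigma>. (Desar n \<sigma>, PIX n \<sigma>)) {\<sigma>. \<sigma> permutes {1..n}}
     (SIGMA v:{v \<in> desar_words. length v \<le> n}. positions n (length v))"
proof (rule bij_betw_byWitness[where f' = "\<lambda>(v, T). word_perm (cat n T v)"])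
  show "(\<lambda>\<sigma>. (Desar n \<sigma>, PIX n \<sigma>)) ` {\<sigma>. \<sigma> permutes {1..n}} \<subseteq>
    (SIGMA v:{v \<in> desar_words. length v \<le> n}. positions n (length v))"
  proof
    fix p assume "p \<in> (\<lambda>\<sigma>. (Desar n \<sigma>, PIX n \<sigma>)) ` {\<sigma>. \<sigma> permutes {1..n}}"
    then obtain \<sigma> where \<sigma>: "\<sigma> permutes {1..n}" "p = (Desar n \<sigma>, PIX n \<sigma>)" by auto
    moreover have "length (Desar n \<sigma>) \<le> n" using Desar_PIX_props(2)[OF \<sigma>(1)] by (simp add: positions_def)
    ultimately show "p \<in> (SIGMA v:{v \<in> desar_words. length v \<le> n}. positions n (length v))"
      using Desar_PIX_props by simp
  qed
  show "\<forall>\<sigma>\<in>{\<sigma>. \<sigma> permutes {1..n}}. (\<lambda>(v, T). word_perm (cat n T v)) (Desar n \<sigma>, PIX n \<sigma>) = \<sigma>"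
    by (simp add: Desar_PIX_props del: One_nat_def)
qed (use Desar_PIX_cat in \<open>fastforce+\<close>)

lemma IDES_Desar_PIX:
  assumes "\<sigma> permutes {1..n}"
  shows "IDES n \<sigma> = merged_DES n (PIX n \<sigma>) (IDES (length (Desar n \<sigma>)) (word_perm (Desar n \<sigma>)))"
  using IDES_cat[OF _ Desar_PIX_props(2)[OF assms]] Desar_PIX_props(1,3)[OF assms]
  by (simp add: desar_words_def)

lemma inversions_Desar_PIX:
  assumes "\<sigma> permutes {1..n}"
  shows "inversions n \<sigma> = excess (PIX n \<sigma>) + inversions (length (Desar n \<sigma>)) (word_perm (Desar n \<sigma>))"
  using inversions_cat[OF _ Desar_PIX_props(2)[OF assms]] Desar_PIX_props(1,3)[OF assms]
  by (simp add: desar_words_def)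

lemma mag_eq: "mag n \<sigma> = excess (PIX n \<sigma>) + imaj (length (Desar n \<sigma>)) (word_perm (Desar n \<sigma>))"
  by (simp add: mag_def excess_def pix_num_def)

subsection \<open>Equidistribution on the symmetric group\<close>

lemma finite_der_words: "finite {d. d \<in> der_words \<and> length d \<le> n}"
  using finite_perm_words[of "\<lambda>d. \<forall>i\<in>{1..length d}. letter d i \<noteq> i" n] by (simp add: der_words_def conj_assoc)

lemma finite_desar_words: "finite {v. v \<in> desar_words \<and> length v \<le> n}"
  using finite_perm_words[of "\<lambda>v. v = [] \<or> desarrangement v" n] by (simp add: desar_words_def conj_assoc)

text \<open>For each derangement word the fixed set runs freely over all subsets of the right size,
  so a distribution splits into a sum over words.\<close>

lemma distr_FIX:
  assumes "\<And>\<sigma>. \<sigma> permutes {1..n} \<Longrightarrow> f \<sigma> = h (Der n \<sigma>) (FIX n \<sigma>)"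
  shows "distr f {\<sigma>. \<sigma> permutes {1..n}} =
    (\<Sum>d | d \<in> der_words \<and> length d \<le> n. distr (h d) (positions n (length d)))"
proof -
  have "distr f {\<sigma>. \<sigma> permutes {1..n}} = distr (\<lambda>\<sigma>. case (Der n \<sigma>, FIX n \<sigma>) of (d, S) \<Rightarrow> h d S) {\<sigma>. \<sigma> permutes {1..n}}"
    by (rule distr_cong) (simp add: assms del: One_nat_def)
  also have "\<dots> = distr (\<lambda>(d, S). h d S) (SIGMA d:{d \<in> der_words. length d \<le> n}. positions n (length d))"
    by (rule distr_bij_betw[OF bij_betw_Der_FIX, symmetric])
  finally show ?thesis by (simp add: distr_Sigma finite_der_words)
qed

lemma distr_PIX:
  assumes "\<And>\<sigma>. \<sigma> permutes {1..n} \<Longrightarrow> f \<sigma> = h (Desar n \<sigma>) (PIX n \<sigma>)"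
  shows "distr f {\<sigma>. \<sigma> permutes {1..n}} =
    (\<Sum>v | v \<in> desar_words \<and> length v \<le> n. distr (h v) (positions n (length v)))"
proof -
  have "distr f {\<sigma>. \<sigma> permutes {1..n}} = distr (\<lambda>\<sigma>. case (Desar n \<sigma>, PIX n \<sigma>) of (v, T) \<Rightarrow> h v T) {\<sigma>. \<sigma> permutes {1..n}}"
    by (rule distr_cong) (simp add: assms del: One_nat_def)
  also have "\<dots> = distr (\<lambda>(v, T). h v T) (SIGMA v:{v \<in> desar_words. length v \<le> n}. positions n (length v))"
    by (rule distr_bij_betw[OF bij_betw_Desar_PIX, symmetric])
  finally show ?thesis by (simp add: distr_Sigma finite_desar_words)
qed

lemma bij_betw_inv_permutes: "bij_betw inv {\<sigma>. \<sigma> permutes A} {\<sigma>. \<sigma> permutes A}"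
  by (rule bij_betw_byWitness[where f' = inv]) (auto simp: permutes_inv permutes_inv_inv)

section \<open>The inverse major index and MacMahon's theorem\<close>

lemma distr_imaj_merged_DES:
  assumes "\<pi> permutes {1..m}" "m \<le> n"
  shows "distr (\<lambda>S. \<Sum>(merged_DES n S (IDES m \<pi>))) (positions n m) = distr (\<lambda>S. excess S + imaj m \<pi>) (positions n m)"
proof -
  \<comment> \<open>The word of \<open>inv \<pi>\<close> has the descent set
    \<open>IDES m \<pi>\<close>, and its letters are positive, so the result on shuffles with zeros
    applies.\<close>
  have "0 \<notin> set (perm_word m (inv \<pi>))"
    using permutes_inv[OF assms(1)] by (intro zero_notin_perm_word perm_word_in_perm_words)
  from distr_maj_merged_DES[OF this, of n] assms(2) show ?thesis
    by (simp add: IDES_def DES_def imaj_def maj_word_def)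
qed

text \<open>MacMahon's theorem, by induction: removal of the first letter changes both statistics alike.\<close>

lemma distr_inversions_eq_imaj:
  "distr (inversions n) {\<sigma>. \<sigma> permutes {1..n}} = distr (imaj n) {\<sigma>. \<sigma> permutes {1..n}}"
proof (induction n)
  case 0
  show ?case by (simp add: inversions_def imaj_def IDES_eq)
next
  case (Suc n)
  let ?P = "{v \<in> perm_words. length v = n}"
  have finP: "finite ?P" by (rule finite_subset[OF _ finite_perm_words[of "\<lambda>_. True" n]]) auto
  \<comment> \<open>T contains one element, the first letter, and v is the reduction of the other
    letters.\<close>
  have bij: "bij_betw (\<lambda>(v, T). word_perm (cat (Suc n) T v)) (?P \<times> positions (Suc n) n) {\<sigma>. \<sigma> permutes {1..Suc n}}"
  proof (rule bij_betw_imageI)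
    show "inj_on (\<lambda>(v, T). word_perm (cat (Suc n) T v)) (?P \<times> positions (Suc n) n)"
    proof (rule inj_onI)
      fix p q assume pq: "p \<in> ?P \<times> positions (Suc n) n" "q \<in> ?P \<times> positions (Suc n) n"
        "(\<lambda>(v, T). word_perm (cat (Suc n) T v)) p = (\<lambda>(v, T). word_perm (cat (Suc n) T v)) q"
      obtain v T v' T' where p: "p = (v, T)" and q: "q = (v', T')" by (metis surj_pair)
      have v: "v \<in> perm_words" "v' \<in> perm_words"
        and T: "T \<in> positions (Suc n) (length v)" "T' \<in> positions (Suc n) (length v')"
        and len: "length v = n" "length v' = n"
        and eq: "word_perm (cat (Suc n) T v) = word_perm (cat (Suc n) T' v')"
        using pq unfolding p q by auto
      have cat: "cat (Suc n) T v = cat (Suc n) T' v'"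
        using perm_word_word_perm[of "cat (Suc n) T v"] perm_word_word_perm[of "cat (Suc n) T' v'"]
        unfolding eq cat_in_perm_words(2)[OF v(1) T(1)] cat_in_perm_words(2)[OF v(2) T(2)] by simp
      have card: "card T = card T'" using T len by (simp add: positions_def)
      have "T = T'"
        using cat_cancel(1)[OF v(1) T(1)] cat_cancel(1)[OF v(2) T(2)] unfolding card cat by simp
      moreover from this have "v = v'"
        using cat_cancel(2)[OF v(1) T(1)] cat_cancel(2)[OF v(2) T(2)] unfolding card cat by simp
      ultimately show "p = q" unfolding p q by simp
    qed
    show "(\<lambda>(v, T). word_perm (cat (Suc n) T v)) ` (?P \<times> positions (Suc n) n) = {\<sigma>. \<sigma> permutes {1..Suc n}}"
    proof (intro equalityI subsetI)
      fix \<sigma> assume "\<sigma> \<in> (\<lambda>(v, T). word_perm (cat (Suc n) T v)) ` (?P \<times> positions (Suc n) n)"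
      then obtain v T where v: "v \<in> perm_words" "T \<in> positions (Suc n) (length v)" "\<sigma> = word_perm (cat (Suc n) T v)" by auto
      show "\<sigma> \<in> {\<sigma>. \<sigma> permutes {1..Suc n}}"
        using word_perm_permutes[OF cat_in_perm_words(1)[OF v(1,2)]]
        unfolding cat_in_perm_words(2)[OF v(1,2)] v(3) by simp
    next
      fix \<sigma> assume "\<sigma> \<in> {\<sigma>. \<sigma> permutes {1..Suc n}}"
      then have \<sigma>: "\<sigma> permutes {1..Suc n}" by simp
      let ?w = "perm_word (Suc n) \<sigma>"
      have "sorted (take 1 ?w)" by (cases ?w) auto
      note parts = cat_take_drop[OF perm_word_in_perm_words[OF \<sigma>] length_perm_word _ this]
      let ?T = "set (take 1 ?w)"
      let ?v = "map (red ({1..Suc n} - ?T)) (drop 1 ?w)"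
      have "\<sigma> = (\<lambda>(v, T). word_perm (cat (Suc n) T v)) (?v, ?T)"
        using parts(3) word_perm_perm_word[OF \<sigma>] by simp
      moreover have "(?v, ?T) \<in> ?P \<times> positions (Suc n) n" using parts(1,2) by simp
      ultimately show "\<sigma> \<in> (\<lambda>(v, T). word_perm (cat (Suc n) T v)) ` (?P \<times> positions (Suc n) n)" by (rule image_eqI)
    qed
  qed
  have sum: "distr f {\<sigma>. \<sigma> permutes {1..Suc n}} = (\<Sum>v\<in>?P. distr (\<lambda>T. excess T + g (word_perm v)) (positions (Suc n) n))"
    if "\<And>v. v \<in> ?P \<Longrightarrow> distr (\<lambda>T. f (word_perm (cat (Suc n) T v))) (positions (Suc n) n) =
      distr (\<lambda>T. excess T + g (word_perm v)) (positions (Suc n) n)" for f and g :: "(nat \<Rightarrow> nat) \<Rightarrow> nat"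
    unfolding distr_bij_betw[OF bij] using that by (simp add: distr_Sigma[OF finP])
  have "distr (inversions (Suc n)) {\<sigma>. \<sigma> permutes {1..Suc n}} =
    (\<Sum>v\<in>?P. distr (\<lambda>T. excess T + inversions n (word_perm v)) (positions (Suc n) n))"
    by (intro sum distr_cong) (auto simp: inversions_cat)
  also have "\<dots> = (\<Sum>v\<in>?P. distr (\<lambda>T. excess T + imaj n (word_perm v)) (positions (Suc n) n))"
  \<comment> \<open>The summand depends on v only through the value of its statistic, so the
    induction hypothesis exchanges inversions for \<open>imaj\<close>.\<close>
  proof (rule sum_distr_cong[of _ _ _ _ "\<lambda>s. distr (\<lambda>T. excess T + s) (positions (Suc n) n)"])
    show "distr (\<lambda>v. inversions n (word_perm v)) ?P = distr (\<lambda>v. imaj n (word_perm v)) ?P"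
      using Suc.IH unfolding distr_bij_betw[OF bij_betw_word_perm] .
  qed
  also have "\<dots> = distr (imaj (Suc n)) {\<sigma>. \<sigma> permutes {1..Suc n}}"
  proof (rule sum[symmetric])
    fix v assume "v \<in> ?P"
    then have v: "v \<in> perm_words" "length v = n" by auto
    \<comment> \<open>For inversions the excess splits off for every single T; for
      \<open>imaj\<close> the distributions over all T are compared.\<close>
    have "distr (\<lambda>T. imaj (Suc n) (word_perm (cat (Suc n) T v))) (positions (Suc n) n) =
      distr (\<lambda>T. \<Sum>(merged_DES (Suc n) T (IDES n (word_perm v)))) (positions (Suc n) n)"
      using v by (intro distr_cong) (simp add: imaj_def IDES_cat)
    also have "\<dots> = distr (\<lambda>T. excess T + imaj n (word_perm v)) (positions (Suc n) n)"
      using word_perm_permutes[OF v(1)] unfolding v(2) by (intro distr_imaj_merged_DES) auto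
    finally show "distr (\<lambda>T. imaj (Suc n) (word_perm (cat (Suc n) T v))) (positions (Suc n) n) =
      distr (\<lambda>T. excess T + imaj n (word_perm v)) (positions (Suc n) n)" .
  qed
  finally show ?case .
qed

section \<open>Descents of derangements and inverse descents of desarrangements\<close>

lemma distr_DES_fixed_Der:
  assumes "d \<in> der_words"
  shows "distr (\<lambda>S. DES_word (ins (Suc (length d)) n S (raise d))) (positions n (length d)) =
         distr (\<lambda>S. merged_DES n S (DES_word d)) (positions n (length d))"
proof -
  have "0 \<notin> set d" using assms zero_notin_perm_word by (simp add: der_words_def)
  then have "distr (\<lambda>S. DES_word (ins (Suc (length d)) n S (raise d))) (positions n (length d)) =
    distr (\<lambda>S. DES_word (ins 0 n S d)) (positions n (length d))"
    \<comment> \<open>\<open>raise d\<close> and d agree in length and descents, so the inserted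
      letter may change from \<open>Suc (length d)\<close> to 0.\<close>
    using distr_DES_ins_eq[of "Suc (length d)" "raise d" 0 d n] raise_props[OF assms] by simp
  also have "\<dots> = distr (\<lambda>S. merged_DES n S (DES_word d)) (positions n (length d))"
    by (rule distr_cong) (simp add: DES_ins_zero \<open>0 \<notin> set d\<close>)
  finally show ?thesis .
qed

text \<open>The theorem of Desarmenien and Wachs. After summation over the positions of the other letters,
  the two sides are the distributions of DES and IDES on the symmetric group.\<close>

lemma distr_DES_der_words:
  "distr (\<lambda>d. (length d, DES_word d)) {d \<in> der_words. length d \<le> n} =
   distr (\<lambda>v. (length v, IDES (length v) (word_perm v))) {v \<in> desar_words. length v \<le> n}"
proof (rule distr_eq_if_graded_sums_eq[where \<Phi> = "\<lambda>n (m, D). distr (\<lambda>S. merged_DES n S D) (positions n m)"])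
  show "finite {d \<in> der_words. length d \<le> n}" for n by (rule finite_der_words)
  show "finite {v \<in> desar_words. length v \<le> n}" for n by (rule finite_desar_words)
  fix n
  have "(\<Sum>d | d \<in> der_words \<and> length d \<le> n. distr (\<lambda>S. merged_DES n S (DES_word d)) (positions n (length d))) =
    (\<Sum>d | d \<in> der_words \<and> length d \<le> n.
      distr (\<lambda>S. DES_word (ins (Suc (length d)) n S (raise d))) (positions n (length d)))"
    by (rule sum.cong) (auto simp: distr_DES_fixed_Der)
  also have "\<dots> = distr (DES n) {\<sigma>. \<sigma> permutes {1..n}}"
    by (rule distr_FIX[symmetric]) (rule DES_eq)
  also have "\<dots> = distr (IDES n) {\<sigma>. \<sigma> permutes {1..n}}"
    unfolding IDES_def by (rule distr_bij_betw[OF bij_betw_inv_permutes])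
  also have "\<dots> = (\<Sum>v | v \<in> desar_words \<and> length v \<le> n.
    distr (\<lambda>S. merged_DES n S (IDES (length v) (word_perm v))) (positions n (length v)))"
    by (rule distr_PIX) (rule IDES_Desar_PIX)
  finally show "(\<Sum>d | d \<in> der_words \<and> length d \<le> n. case (length d, DES_word d) of
      (m, D) \<Rightarrow> distr (\<lambda>S. merged_DES n S D) (positions n m)) =
    (\<Sum>v | v \<in> desar_words \<and> length v \<le> n. case (length v, IDES (length v) (word_perm v)) of
      (m, D) \<Rightarrow> distr (\<lambda>S. merged_DES n S D) (positions n m))" by simp
next
  fix d :: "nat list"
  \<comment> \<open>If n is the length of d, only the empty subset occurs, and merging returns the
    descent set itself.\<close>
  have "DES_word d \<subseteq> {1..<length d}" by (auto simp: DES_word_def)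
  then show "(case (length d, DES_word d) of (m, D) \<Rightarrow> distr (\<lambda>S. merged_DES (length d) S D) (positions (length d) m)) =
    {#DES_word d#}" by (simp add: merged_DES_empty)
next
  fix v :: "nat list"
  have "IDES (length v) (word_perm v) \<subseteq> {1..<length v}" by (auto simp: IDES_eq)
  then show "(case (length v, IDES (length v) (word_perm v)) of
      (m, D) \<Rightarrow> distr (\<lambda>S. merged_DES (length v) S D) (positions (length v) m)) =
    {#IDES (length v) (word_perm v)#}" by (simp add: merged_DES_empty)
qed

text \<open>With \<open>excess T\<close> added and T varying, the two sides become the distributions
  of \<open>imaj\<close> and inversions on the symmetric group. MacMahon's theorem equates them, and
  the graded cancellation returns to desarrangements.\<close>

lemma distr_imaj_desar_words:
  "distr (\<lambda>v. (length v, imaj (length v) (word_perm v))) {v \<in> desar_words. length v \<le> n} =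
   distr (\<lambda>v. (length v, inversions (length v) (word_perm v))) {v \<in> desar_words. length v \<le> n}"
proof (rule distr_eq_if_graded_sums_eq[where \<Phi> = "\<lambda>n (m, s). distr (\<lambda>T. excess T + s) (positions n m)"])
  show "finite {v \<in> desar_words. length v \<le> n}" for n by (rule finite_desar_words)
  then show "finite {v \<in> desar_words. length v \<le> n}" for n .
  fix n
  have "(\<Sum>v | v \<in> desar_words \<and> length v \<le> n.
      distr (\<lambda>T. excess T + imaj (length v) (word_perm v)) (positions n (length v))) =
    (\<Sum>v | v \<in> desar_words \<and> length v \<le> n.
      distr (\<lambda>T. \<Sum>(merged_DES n T (IDES (length v) (word_perm v)))) (positions n (length v)))"
    by (intro sum.cong refl distr_imaj_merged_DES[symmetric])
      (auto simp: desar_words_def simp del: One_nat_def intro: word_perm_permutes)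
  also have "\<dots> = distr (imaj n) {\<sigma>. \<sigma> permutes {1..n}}"
    by (rule distr_PIX[symmetric]) (simp only: imaj_def IDES_Desar_PIX)
  also have "\<dots> = distr (inversions n) {\<sigma>. \<sigma> permutes {1..n}}"
    by (rule distr_inversions_eq_imaj[symmetric])
  also have "\<dots> = (\<Sum>v | v \<in> desar_words \<and> length v \<le> n.
      distr (\<lambda>T. excess T + inversions (length v) (word_perm v)) (positions n (length v)))"
    by (rule distr_PIX) (rule inversions_Desar_PIX)
  finally show "(\<Sum>v | v \<in> desar_words \<and> length v \<le> n. case (length v, imaj (length v) (word_perm v)) of
      (m, s) \<Rightarrow> distr (\<lambda>T. excess T + s) (positions n m)) =
    (\<Sum>v | v \<in> desar_words \<and> length v \<le> n. case (length v, inversions (length v) (word_perm v)) of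
      (m, s) \<Rightarrow> distr (\<lambda>T. excess T + s) (positions n m))" by simp
qed (simp_all add: excess_def)

section \<open>Joint distributions with fixed and pixed points\<close>

lemma distr_card_positions:
  "distr (\<lambda>S. (card S, f S)) (positions n m) = image_mset (Pair (n - m)) (distr f (positions n m))"
  \<comment> \<open>All members of \<open>positions n m\<close> have n - m elements, so for a fixed
    word the number of fixed or pixed points is a constant that can be carried along.\<close>
  unfolding image_mset_distr by (rule distr_cong) (auto simp: positions_def)

lemma distr_fix_DES:
  "distr (\<lambda>\<sigma>. (fix_num n \<sigma>, DES n \<sigma>)) {\<sigma>. \<sigma> permutes {1..n}} =
   distr (\<lambda>\<sigma>. (fix_num n \<sigma>, DEZ n \<sigma>)) {\<sigma>. \<sigma> permutes {1..n}}"
proof -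
  have "distr (\<lambda>\<sigma>. (fix_num n \<sigma>, DES n \<sigma>)) {\<sigma>. \<sigma> permutes {1..n}} =
    (\<Sum>d | d \<in> der_words \<and> length d \<le> n.
      distr (\<lambda>S. (card S, DES_word (ins (Suc (length d)) n S (raise d)))) (positions n (length d)))"
    by (rule distr_FIX) (simp only: fix_num_def DES_eq)
  also have "\<dots> = (\<Sum>d | d \<in> der_words \<and> length d \<le> n.
      distr (\<lambda>S. (card S, merged_DES n S (DES_word d))) (positions n (length d)))"
    by (rule sum.cong) (auto simp: distr_card_positions distr_DES_fixed_Der)
  also have "\<dots> = distr (\<lambda>\<sigma>. (fix_num n \<sigma>, DEZ n \<sigma>)) {\<sigma>. \<sigma> permutes {1..n}}"
    by (rule distr_FIX[symmetric]) (simp only: fix_num_def DEZ_eq)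
  finally show ?thesis .
qed

text \<open>Both pairs are the same function of a subset and a set of descents, belonging to
  \<open>Der\<close> or to the inverse of \<open>Desar\<close>; by
  \<open>distr_DES_der_words\<close> the two kinds of words can be exchanged.\<close>

lemma distr_FIX_DEZ:
  "distr (\<lambda>\<sigma>. (FIX n \<sigma>, DEZ n \<sigma>)) {\<sigma>. \<sigma> permutes {1..n}} =
   distr (\<lambda>\<sigma>. (PIX n \<sigma>, IDES n \<sigma>)) {\<sigma>. \<sigma> permutes {1..n}}"
proof -
  let ?\<phi> = "\<lambda>(m, D). distr (\<lambda>S. (S, merged_DES n S D)) (positions n m)"
  have "distr (\<lambda>\<sigma>. (FIX n \<sigma>, DEZ n \<sigma>)) {\<sigma>. \<sigma> permutes {1..n}} =
    (\<Sum>d | d \<in> der_words \<and> length d \<le> n. ?\<phi> (length d, DES_word d))"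
    unfolding prod.case by (rule distr_FIX) (simp only: DEZ_eq)
  also have "\<dots> = (\<Sum>v | v \<in> desar_words \<and> length v \<le> n. ?\<phi> (length v, IDES (length v) (word_perm v)))"
    by (rule sum_distr_cong[OF distr_DES_der_words])
  also have "\<dots> = distr (\<lambda>\<sigma>. (PIX n \<sigma>, IDES n \<sigma>)) {\<sigma>. \<sigma> permutes {1..n}}"
    unfolding prod.case by (rule distr_PIX[symmetric]) (simp only: IDES_Desar_PIX)
  finally show ?thesis .
qed

text \<open>The same exchange, applied to the sums of these descent sets.\<close>

lemma distr_FIX_maf:
  "distr (\<lambda>\<sigma>. (FIX n \<sigma>, maf n \<sigma>)) {\<sigma>. \<sigma> permutes {1..n}} =
   distr (\<lambda>\<sigma>. (PIX n \<sigma>, mag n \<sigma>)) {\<sigma>. \<sigma> permutes {1..n}}"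
proof -
  let ?\<phi> = "\<lambda>(m, D). distr (\<lambda>S. (S, excess S + \<Sum>D)) (positions n m)"
  have "distr (\<lambda>\<sigma>. (FIX n \<sigma>, maf n \<sigma>)) {\<sigma>. \<sigma> permutes {1..n}} =
    (\<Sum>d | d \<in> der_words \<and> length d \<le> n. ?\<phi> (length d, DES_word d))"
    unfolding prod.case by (rule distr_FIX) (simp only: maf_eq maj_word_def)
  also have "\<dots> = (\<Sum>v | v \<in> desar_words \<and> length v \<le> n. ?\<phi> (length v, IDES (length v) (word_perm v)))"
    by (rule sum_distr_cong[OF distr_DES_der_words])
  also have "\<dots> = distr (\<lambda>\<sigma>. (PIX n \<sigma>, mag n \<sigma>)) {\<sigma>. \<sigma> permutes {1..n}}"
    unfolding prod.case by (rule distr_PIX[symmetric]) (simp only: mag_eq imaj_def)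
  finally show ?thesis .
qed

text \<open>The subset and its excess stay; only \<open>imaj\<close> is exchanged for inversions on
  the desarrangements of each length.\<close>

lemma distr_PIX_mag:
  "distr (\<lambda>\<sigma>. (PIX n \<sigma>, mag n \<sigma>)) {\<sigma>. \<sigma> permutes {1..n}} =
   distr (\<lambda>\<sigma>. (PIX n \<sigma>, inversions n \<sigma>)) {\<sigma>. \<sigma> permutes {1..n}}"
proof -
  let ?\<phi> = "\<lambda>(m, s). distr (\<lambda>T. (T, excess T + s)) (positions n m)"
  have "distr (\<lambda>\<sigma>. (PIX n \<sigma>, mag n \<sigma>)) {\<sigma>. \<sigma> permutes {1..n}} =
    (\<Sum>v | v \<in> desar_words \<and> length v \<le> n. ?\<phi> (length v, imaj (length v) (word_perm v)))"
    unfolding prod.case by (rule distr_PIX) (simp only: mag_eq)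
  also have "\<dots> = (\<Sum>v | v \<in> desar_words \<and> length v \<le> n. ?\<phi> (length v, inversions (length v) (word_perm v)))"
    by (rule sum_distr_cong[OF distr_imaj_desar_words])
  also have "\<dots> = distr (\<lambda>\<sigma>. (PIX n \<sigma>, inversions n \<sigma>)) {\<sigma>. \<sigma> permutes {1..n}}"
    unfolding prod.case by (rule distr_PIX[symmetric]) (simp only: inversions_Desar_PIX)
  finally show ?thesis .
qed

text \<open>The comparison is made for each derangement word separately, as distributions over all
  subsets of one size; this retains the number of fixed points but not the set.\<close>

lemma distr_fix_maf:
  "distr (\<lambda>\<sigma>. (fix_num n \<sigma>, maf n \<sigma>)) {\<sigma>. \<sigma> permutes {1..n}} =
   distr (\<lambda>\<sigma>. (fix_num n \<sigma>, maz n \<sigma>)) {\<sigma>. \<sigma> permutes {1..n}}"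
proof -
  have "distr (\<lambda>\<sigma>. (fix_num n \<sigma>, maf n \<sigma>)) {\<sigma>. \<sigma> permutes {1..n}} =
    (\<Sum>d | d \<in> der_words \<and> length d \<le> n.
      distr (\<lambda>S. (card S, excess S + maj_word d)) (positions n (length d)))"
    by (rule distr_FIX) (simp only: fix_num_def maf_eq)
  also have "\<dots> = (\<Sum>d | d \<in> der_words \<and> length d \<le> n.
      distr (\<lambda>S. (card S, \<Sum>(merged_DES n S (DES_word d)))) (positions n (length d)))"
  proof (rule sum.cong[OF refl])
    fix d assume "d \<in> {d. d \<in> der_words \<and> length d \<le> n}"
    then have "0 \<notin> set d" "length d \<le> n" using zero_notin_perm_word by (auto simp: der_words_def)
    then show "distr (\<lambda>S. (card S, excess S + maj_word d)) (positions n (length d)) =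
      distr (\<lambda>S. (card S, \<Sum>(merged_DES n S (DES_word d)))) (positions n (length d))"
      unfolding distr_card_positions by (simp only: distr_maj_merged_DES[OF \<open>0 \<notin> set d\<close> \<open>length d \<le> n\<close>])
  qed
  also have "\<dots> = distr (\<lambda>\<sigma>. (fix_num n \<sigma>, maz n \<sigma>)) {\<sigma>. \<sigma> permutes {1..n}}"
    by (rule distr_FIX[symmetric]) (simp only: fix_num_def maz_eq DEZ_eq)
  finally show ?thesis .
qed

theorem theorem1p2:
  fixes n :: nat
  shows "equidistributed n
           {\<lambda>\<sigma>. (fix_num n \<sigma>, maj n \<sigma>),
            \<lambda>\<sigma>. (fix_num n \<sigma>, maf n \<sigma>),
            \<lambda>\<sigma>. (fix_num n \<sigma>, maz n \<sigma>),
            \<lambda>\<sigma>. (pix_num n \<sigma>, mag n \<sigma>),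
            \<lambda>\<sigma>. (pix_num n \<sigma>, inversions n \<sigma>),
            \<lambda>\<sigma>. (pix_num n \<sigma>, imaj n \<sigma>)} \<and>
         equidistributed n
           {\<lambda>\<sigma>. (FIX n \<sigma>, maf n \<sigma>),
            \<lambda>\<sigma>. (PIX n \<sigma>, mag n \<sigma>),
            \<lambda>\<sigma>. (PIX n \<sigma>, inversions n \<sigma>)} \<and>
         equidistributed n
           {\<lambda>\<sigma>. (fix_num n \<sigma>, DEZ n \<sigma>),
            \<lambda>\<sigma>. (fix_num n \<sigma>, DES n \<sigma>),
            \<lambda>\<sigma>. (pix_num n \<sigma>, IDES n \<sigma>)} \<and>
         equidistributed n
           {\<lambda>\<sigma>. (FIX n \<sigma>, DEZ n \<sigma>),
            \<lambda>\<sigma>. (PIX n \<sigma>, IDES n \<sigma>)}"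
proof -
  let ?S = "{\<sigma>. \<sigma> permutes {1..n}}"
  \<comment> \<open>Equidistribution passes to functions of the pairs: \<open>Sum\<close> turns
    descent sets into major indices, and \<open>card\<close> turns \<open>FIX\<close> and
    \<open>PIX\<close> into their sizes.\<close>
  have image: "distr (\<lambda>\<sigma>. h (f \<sigma>)) ?S = distr (\<lambda>\<sigma>. h (g \<sigma>)) ?S"
    if "distr f ?S = distr g ?S" for f g :: "(nat \<Rightarrow> nat) \<Rightarrow> 'a" and h :: "'a \<Rightarrow> 'b"
    using arg_cong[OF that, of "image_mset h"] by (simp only: image_mset_distr)
  have maj: "distr (\<lambda>\<sigma>. (fix_num n \<sigma>, maj n \<sigma>)) ?S = distr (\<lambda>\<sigma>. (fix_num n \<sigma>, maz n \<sigma>)) ?S"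
    using image[OF distr_fix_DES, of "map_prod id Sum"] by (simp add: maj_eq maz_eq)
  have imaj: "distr (\<lambda>\<sigma>. (fix_num n \<sigma>, maz n \<sigma>)) ?S = distr (\<lambda>\<sigma>. (pix_num n \<sigma>, imaj n \<sigma>)) ?S"
    using image[OF distr_FIX_DEZ, of "map_prod card Sum"]
    by (simp add: maz_eq imaj_def fix_num_def pix_num_def)
  have mag: "distr (\<lambda>\<sigma>. (fix_num n \<sigma>, maf n \<sigma>)) ?S = distr (\<lambda>\<sigma>. (pix_num n \<sigma>, mag n \<sigma>)) ?S"
    using image[OF distr_FIX_maf, of "map_prod card id"] by (simp add: fix_num_def pix_num_def)
  have inv: "distr (\<lambda>\<sigma>. (pix_num n \<sigma>, mag n \<sigma>)) ?S = distr (\<lambda>\<sigma>. (pix_num n \<sigma>, inversions n \<sigma>)) ?S"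
    using image[OF distr_PIX_mag, of "map_prod card id"] by (simp add: pix_num_def)
  have IDES: "distr (\<lambda>\<sigma>. (fix_num n \<sigma>, DEZ n \<sigma>)) ?S = distr (\<lambda>\<sigma>. (pix_num n \<sigma>, IDES n \<sigma>)) ?S"
    using image[OF distr_FIX_DEZ, of "map_prod card id"] by (simp add: fix_num_def pix_num_def)
  show ?thesis
  proof (intro conjI)
    \<comment> \<open>All pairs are compared with that of \<open>maz\<close>: those of
      \<open>maj\<close>, \<open>maf\<close> and \<open>imaj\<close> directly, that of
      \<open>mag\<close> through \<open>maf\<close>, and that of \<open>inversions\<close> through
      \<open>mag\<close>.\<close>
    show "equidistributed n
           {\<lambda>\<sigma>. (fix_num n \<sigma>, maj n \<sigma>),
            \<lambda>\<sigma>. (fix_num n \<sigma>, maf n \<sigma>),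
            \<lambda>\<sigma>. (fix_num n \<sigma>, maz n \<sigma>),
            \<lambda>\<sigma>. (pix_num n \<sigma>, mag n \<sigma>),
            \<lambda>\<sigma>. (pix_num n \<sigma>, inversions n \<sigma>),
            \<lambda>\<sigma>. (pix_num n \<sigma>, imaj n \<sigma>)}"
      by (rule equidistributedI[of _ _ "distr (\<lambda>\<sigma>. (fix_num n \<sigma>, maz n \<sigma>)) ?S"])
        (use maj imaj mag inv distr_fix_maf[of n] in \<open>elim insertE emptyE; simp only:\<close>)
    show "equidistributed n
           {\<lambda>\<sigma>. (FIX n \<sigma>, maf n \<sigma>),
            \<lambda>\<sigma>. (PIX n \<sigma>, mag n \<sigma>),
            \<lambda>\<sigma>. (PIX n \<sigma>, inversions n \<sigma>)}"
      by (rule equidistributedI[of _ _ "distr (\<lambda>\<sigma>. (PIX n \<sigma>, inversions n \<sigma>)) ?S"])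
        (use distr_FIX_maf[of n] distr_PIX_mag[of n] in \<open>elim insertE emptyE; simp only:\<close>)
    show "equidistributed n
           {\<lambda>\<sigma>. (fix_num n \<sigma>, DEZ n \<sigma>),
            \<lambda>\<sigma>. (fix_num n \<sigma>, DES n \<sigma>),
            \<lambda>\<sigma>. (pix_num n \<sigma>, IDES n \<sigma>)}"
      by (rule equidistributedI[of _ _ "distr (\<lambda>\<sigma>. (pix_num n \<sigma>, IDES n \<sigma>)) ?S"])
        (use distr_fix_DES[of n] IDES in \<open>elim insertE emptyE; simp only:\<close>)
    show "equidistributed n
           {\<lambda>\<sigma>. (FIX n \<sigma>, DEZ n \<sigma>),
            \<lambda>\<sigma>. (PIX n \<sigma>, IDES n \<sigma>)}"
      by (rule equidistributedI[of _ _ "distr (\<lambda>\<sigma>. (PIX n \<sigma>, IDES n \<sigma>)) ?S"])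
        (use distr_FIX_DEZ[of n] in \<open>elim insertE emptyE; simp only:\<close>)
  qed
qed

end
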